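(* Let $a,b,N$ be nonnegative integers with $1\le b\le a\le N$. Let $\mathcal M=\{M_0,\dots,M_{b-1}\}$ be a (indexed) set of $b$ real parameters with $M_i\ne0,1$, and write $\mathcal M^{-1}=\{1/M_0,\dots,1/M_{b-1}\}$. Let $U$ be a finite set of complex numbers, with $n_U$ elements, such that $u+v\neq-a-b-1$ for all $u,v\in U$. Let $$\nu_{a,b,N}^{\mathcal M,U}=\prod_{u\in U}(x-\lambda^{a,b}(u))\,\nu_{a,b,N}^{\mathcal M},$$ with $\nu_{a,b,N}^{\mathcal M}$ as in the context, and let $n_S$ be the number of elements of $\{\lambda^{a,b}(i):i=-b,\dots,N\}\setminus\{\lambda^{a,b}(u):u\in U\}$; assume $n_S>0$. Let $\Psi_n^{a,b,N;\mathcal M,U}$ be the determinant of the $(b+n_U)\times(b+n_U)$ matrix with columns $j=1,\dots,b+n_U$ whose first $b$ rows, indexed by $f=a,a+1,\dots,a+b-1$ in increasing order, have entries $$(-N-a-b)_{n+j-1}\,W_f^{a,b,-2-N-a-b;\mathcal M^{-1}}(N+a+b-n-j+1),$$ and whose last $n_U$ rows, indexed by $u\in U$ in increasing lexicographic order, have entries $R_{n-b+j-1}^{b,a,N}(\lambda^{a,b}(u))$. Then the measure $\nu_{a,b,N}^{\mathcal M,U}$ has a sequence $(p_n)_{n=0}^{n_S-1}$ of orthogonal polynomials if and only if $$\Psi_n^{a,b,N;\mathcal M,U}\neq0,\qquad n=0,1,\dots,n_S.$$ In that case, define $r_n^{a,b,N;\mathcal M,U}(x)$, $n=0,\dots,n_S-1$,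 as the quotient by $\prod_{u\in U}(x-\lambda^{a,b}(u))$ of the determinant of the $(b+n_U+1)\times(b+n_U+1)$ matrix with columns $j=1,\dots,b+n_U+1$ whose first row has entries $R_{n-b+j-1}^{b,a,N}(x)$, whose next $b$ rows, indexed by $f=a,\dots,a+b-1$, have entries $(-N-a-b)_{n+j-1}W_f^{a,b,-2-N-a-b;\mathcal M^{-1}}(N+a+b-n-j+1)$, and whose last $n_U$ rows, indexed by $u\in U$, have entries $R_{n-b+j-1}^{b,a,N}(\lambda^{a,b}(u))$. Then the sequence of polynomials $(r_n^{a,b,N;\mathcal M,U})_{n=0}^{n_S-1}$ is orthogonal with respect to $\nu_{a,b,N}^{\mathcal M,U}$, with $$\langle r_n^{a,b,N;\mathcal M,U},r_n^{a,b,N;\mathcal M,U}\rangle_{\nu_{a,b,N}^{\mathcal M,U}}=\frac{n!\,\big((-N-a-b)_n\big)^2\,(N+b+1-n)_a}{(-1)^{n_U+b}\,(n+n_U)!\,\big((N+b+1)_a\big)^2}\,\Psi_n^{a,b,N;\mathcal M,U}\,\Psi_{n+1}^{a,b,N;\mathcal M,U}.$$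
   Context: Notation. $(x)_m=x(x+1)\cdots(x+m-1)$ is the Pochhammer symbol. $\delta_y$ is the unit point mass at $y$. $\lambda^{a,b}(x)=x(x+a+b+1)$. Lexicographic order on $\mathbb C$: $u<w$ if $\Re u<\Re w$, or $\Re u=\Re w$ and $\Im u<\Im w$. Orthogonality. For a (not necessarily positive, possibly complex) measure $\mu$, $\langle p,q\rangle_\mu=\int pq\,d\mu$ (bilinear). A sequence $(p_n)_{n=0}^K$ with $\deg p_n=n$ is orthogonal with respect to $\mu$ if $\langle p_n,p_m\rangle_\mu=0$ for $n\ne m$ and $\langle p_n,p_n\rangle_\mu\neq0$ for all $n\le K$. Dual Hahn polynomials (note that they are used below with $a$ and $b$ interchanged): for $n\ge 0$, $$R_n^{a,b,N}(x)=\sum_{j=0}^n\frac{(-n)_j(-N+j)_{n-j}(a+j+1)_{n-j}}{n!\,(-1)^j\,j!}\prod_{i=0}^{j-1}\big(x-i(a+b+1+i)\big),$$ and $R_n^{a,b,N}=0$ for $n<0$. Hahn polynomials (for arbitrary real parameters $a,b,N$): $$h_n^{a,b,N}(x)=\sum_{j=0}^n\frac{(-n)_j(a+b+n+1)_j(-N+j)_{n-j}(a+j+1)_{n-j}(-x)_j}{j!}.$$ Dual Hahn masses: for $x=0,\dots,N$, $$\rho_{b,a,N}(x)=\frac{(2x+a+b+1)(b+1)_x(-N)_x\,N!}{(-1)^x(x+a+b+1)_{N+1}(a+1)_x\,x!}.$$ The measure: $$\nu_{a,b,N}^{\mathcal M}=\sum_{x=-b}^{-1}\frac{(2x+a+b+1)(N+1-x)_{x+b}}{(N+b+1)_{x+a+1}}M_{x+b}\,\delta_{\lambda^{a,b}(x)}+\frac{((N+1)_b)^2}{(b+1)_{a-b}}\sum_{x=0}^N\frac{\rho_{b,a,N}(x)}{\prod_{i=0}^{b-1}(x+a+i+1)(x+b-i)}\,\delta_{\lambda^{a,b}(x)}.$$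 For a polynomial $r$ and a measure $\mu$, $r\mu$ is the measure obtained by multiplying the mass at each point $y$ by $r(y)$. Polynomials $W_g^{a,b,L;\mathcal K}(x)$, for an integer $L$ (possibly negative), a set of parameters $\mathcal K=\{K_0,\dots,K_{b-1}\}$ with $K_i\ne 1$, and $a\le g\le a+b-1$ (the only range needed here): $$W_g^{a,b,L;\mathcal K}(x)=(-1)^{b+g}(g-b)!\Big[(b+a-g-1)!\,(-x)_a\,h_{g-a}^{a,-b,-2-L-a}(x-a)+\frac{(g-a)!\,(L+a+b+1-g)_{2g-a-b+1}}{K_{g-a}-1}\,h_{a+b-g-1}^{-a,-b,-2-L}(x)\Big].$$ *)

theory Defs
  imports
    Complex_Main
    "HOL-Library.Poly_Mapping"
    "Jordan_Normal_Form.Determinant"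
begin

text \<open>All index arithmetic on natural numbers below is used only in ranges where the truncated
  subtraction is the true one; the parameters of the polynomials are complex numbers, which
  includes the real ones.\<close>

definition lambda_ab :: "nat \<Rightarrow> nat \<Rightarrow> complex \<Rightarrow> complex" where
  "lambda_ab a b x = x * (x + of_nat a + of_nat b + 1)"

definition dual_hahn :: "int \<Rightarrow> complex \<Rightarrow> complex \<Rightarrow> complex \<Rightarrow> complex poly" where
  "dual_hahn k a b N =
    (if k < 0 then 0
     else (let n = nat k in
       \<Sum>j\<le>n. smult
         (pochhammer (- of_nat n) j * pochhammer (- N + of_nat j) (n - j)
            * pochhammer (a + of_nat j + 1) (n - j) / (fact n * (-1) ^ j * fact j))
         (\<Prod>i<j. [: - (of_nat i * (a + b + 1 + of_nat i)), 1 :])))"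

definition hahn :: "nat \<Rightarrow> complex \<Rightarrow> complex \<Rightarrow> complex \<Rightarrow> complex \<Rightarrow> complex" where
  "hahn n a b N x =
    (\<Sum>j\<le>n. pochhammer (- of_nat n) j * pochhammer (a + b + of_nat n + 1) j
        * pochhammer (- N + of_nat j) (n - j) * pochhammer (a + of_nat j + 1) (n - j)
        * pochhammer (- x) j / fact j)"

text \<open>The polynomials \<open>W\<^sub>g\<close>, meant for \<open>1 \<le> b \<le> a \<le> g \<le> a + b - 1\<close>.
  The parameter set is the indexed family \<open>K 0, \<dots>, K (b - 1)\<close>.\<close>

definition W_poly :: "nat \<Rightarrow> nat \<Rightarrow> int \<Rightarrow> (nat \<Rightarrow> real) \<Rightarrow> nat \<Rightarrow> complex \<Rightarrow> complex" where
  "W_poly a b L K g x =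
    (-1) ^ (b + g) * fact (g - b) *
      (fact (b + a - g - 1) * pochhammer (- x) a
         * hahn (g - a) (of_nat a) (- of_nat b) (-2 - of_int L - of_nat a) (x - of_nat a)
       + fact (g - a)
         * pochhammer (of_int L + of_nat a + of_nat b + 1 - of_nat g) (2 * g + 1 - a - b)
         / (of_real (K (g - a)) - 1)
         * hahn (a + b - g - 1) (- of_nat a) (- of_nat b) (-2 - of_int L) x)"

text \<open>A finitely supported complex measure is the finitely supported function
  \<open>y \<mapsto> mass at y\<close>; thus \<open>m \<delta>\<^sub>y\<close> is \<open>Poly_Mapping.single y m\<close>, and masses at
  coinciding points add up.\<close>

type_synonym discrete_measure = "complex \<Rightarrow>\<^sub>0 complex"

definition integral_dm :: "discrete_measure \<Rightarrow> (complex \<Rightarrow> complex) \<Rightarrow> complex" where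
  "integral_dm \<mu> f = (\<Sum>y \<in> Poly_Mapping.keys \<mu>. f y * Poly_Mapping.lookup \<mu> y)"

definition poly_times_dm :: "complex poly \<Rightarrow> discrete_measure \<Rightarrow> discrete_measure" where
  "poly_times_dm r \<mu> = Poly_Mapping.mapp (\<lambda>y m. poly r y * m) \<mu>"

definition pairing :: "discrete_measure \<Rightarrow> complex poly \<Rightarrow> complex poly \<Rightarrow> complex" where
  "pairing \<mu> p q = integral_dm \<mu> (\<lambda>y. poly p y * poly q y)"

definition orthogonal_polys :: "discrete_measure \<Rightarrow> nat \<Rightarrow> (nat \<Rightarrow> complex poly) \<Rightarrow> bool" where
  "orthogonal_polys \<mu> K p \<longleftrightarrow>
    (\<forall>n\<le>K. degree (p n) = n) \<and>
    (\<forall>n\<le>K. \<forall>m\<le>K. n \<noteq> m \<longrightarrow> pairing \<mu> (p n) (p m) = 0) \<and>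
    (\<forall>n\<le>K. pairing \<mu> (p n) (p n) \<noteq> 0)"

text \<open>The mass written \<open>\<rho>\<^bsub>b,a,N\<^esub>(x)\<close>; note the order of the first two arguments.\<close>

definition dual_hahn_mass :: "nat \<Rightarrow> nat \<Rightarrow> nat \<Rightarrow> nat \<Rightarrow> complex" where
  "dual_hahn_mass b a N x =
    (2 * of_nat x + of_nat a + of_nat b + 1) * pochhammer (of_nat b + 1) x
      * pochhammer (- of_nat N) x * fact N
    / ((-1) ^ x * pochhammer (of_nat x + of_nat a + of_nat b + 1) (N + 1)
      * pochhammer (of_nat a + 1) x * fact x)"

definition nu_measure :: "nat \<Rightarrow> nat \<Rightarrow> nat \<Rightarrow> (nat \<Rightarrow> real) \<Rightarrow> discrete_measure" where
  "nu_measure a b N M =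
    (\<Sum>x \<in> {- int b..-1}. Poly_Mapping.single (lambda_ab a b (of_int x))
       ((2 * of_int x + of_nat a + of_nat b + 1)
          * pochhammer (of_nat N + 1 - of_int x) (nat (x + int b))
          / pochhammer (of_nat N + of_nat b + 1) (nat (x + int a + 1))
          * of_real (M (nat (x + int b)))))
    + (\<Sum>x \<in> {0..N}. Poly_Mapping.single (lambda_ab a b (of_nat x))
       ((pochhammer (of_nat N + 1) b)\<^sup>2 / pochhammer (of_nat b + 1) (a - b)
          * (dual_hahn_mass b a N x
             / (\<Prod>i<b. (of_nat x + of_nat a + of_nat i + 1) * (of_nat x + of_nat b - of_nat i)))))"

definition U_poly :: "nat \<Rightarrow> nat \<Rightarrow> complex set \<Rightarrow> complex poly" where
  "U_poly a b U = (\<Prod>u\<in>U. [: - lambda_ab a b u, 1 :])"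

definition nu_measure_U ::
    "nat \<Rightarrow> nat \<Rightarrow> nat \<Rightarrow> (nat \<Rightarrow> real) \<Rightarrow> complex set \<Rightarrow> discrete_measure" where
  "nu_measure_U a b N M U = poly_times_dm (U_poly a b U) (nu_measure a b N M)"

definition complex_lex_less :: "complex \<Rightarrow> complex \<Rightarrow> bool" where
  "complex_lex_less u w \<longleftrightarrow> Re u < Re w \<or> (Re u = Re w \<and> Im u < Im w)"

definition complex_lex_le :: "complex \<Rightarrow> complex \<Rightarrow> bool" where
  "complex_lex_le u w \<longleftrightarrow> complex_lex_less u w \<or> u = w"

interpretation complex_lex: linorder complex_lex_le complex_lex_less
  by standard (auto simp: complex_lex_le_def complex_lex_less_def complex_eq_iff)

text \<open>In the matrices below, rows and columns are counted from \<open>0\<close>: the column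
  index \<open>j\<close> stands for \<open>j - 1\<close> in the usual one-based numbering.\<close>

definition W_entry :: "nat \<Rightarrow> nat \<Rightarrow> nat \<Rightarrow> (nat \<Rightarrow> real) \<Rightarrow> nat \<Rightarrow> nat \<Rightarrow> nat \<Rightarrow> complex" where
  "W_entry a b N M n f j =
    pochhammer (- of_nat N - of_nat a - of_nat b) (n + j)
      * W_poly a b (-2 - int N - int a - int b) (\<lambda>i. 1 / M i) f
          (of_nat N + of_nat a + of_nat b - of_nat n - of_nat j)"

definition R_entry :: "nat \<Rightarrow> nat \<Rightarrow> nat \<Rightarrow> nat \<Rightarrow> nat \<Rightarrow> complex poly" where
  "R_entry a b N n j = dual_hahn (int n - int b + int j) (of_nat b) (of_nat a) (of_nat N)"

definition Psi :: "nat \<Rightarrow> nat \<Rightarrow> nat \<Rightarrow> (nat \<Rightarrow> real) \<Rightarrow> complex set \<Rightarrow> nat \<Rightarrow> complex" where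
  "Psi a b N M U n =
    (let us = complex_lex.sorted_list_of_set U; m = b + card U in
     Determinant.det (Matrix.mat m m (\<lambda>(i, j).
       if i < b then W_entry a b N M n (a + i) j
       else poly (R_entry a b N n j) (lambda_ab a b (us ! (i - b))))))"

definition r_det :: "nat \<Rightarrow> nat \<Rightarrow> nat \<Rightarrow> (nat \<Rightarrow> real) \<Rightarrow> complex set \<Rightarrow> nat \<Rightarrow> complex poly" where
  "r_det a b N M U n =
    (let us = complex_lex.sorted_list_of_set U; m = b + card U + 1 in
     Determinant.det (Matrix.mat m m (\<lambda>(i, j).
       if i = 0 then R_entry a b N n j
       else if i \<le> b then [: W_entry a b N M n (a + (i - 1)) j :]
       else [: poly (R_entry a b N n j) (lambda_ab a b (us ! (i - 1 - b))) :])))"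

definition r_poly :: "nat \<Rightarrow> nat \<Rightarrow> nat \<Rightarrow> (nat \<Rightarrow> real) \<Rightarrow> complex set \<Rightarrow> nat \<Rightarrow> complex poly" where
  "r_poly a b N M U n = r_det a b N M U n div U_poly a b U"

end

theory Submission
  imports Defs
begin

text \<open>
  Write \<open>q k\<close> for the dual Hahn polynomial of degree \<open>k - b\<close>. Christoffel's argument reduces the
  theorem to one formula: for \<open>degree p \<le> k\<close>, the pairing of \<open>q k\<close> and \<open>p\<close> under the measure is
  \<open>(\<Sum>i<b. p (\<lambda> (i - b)) * T i k) + coeff p k * Delta k\<close>, where \<open>T i k\<close> is a nonzero multiple of the
  entry made from \<open>W_poly\<close>. Hence a combination of \<open>q n, q (n + 1), \<dots>\<close> whose coefficients are
  orthogonal to the \<open>b\<close> rows of \<open>T\<close> pairs to zero with every degree below \<open>n\<close>.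

  The sequences \<open>q k\<close> at a fixed point and \<open>T i k\<close> satisfy the same three-term recurrence in \<open>k\<close>, for
  the latter by the difference equation of the Hahn polynomials. The coefficient of \<open>q (k + 1)\<close>
  vanishes at \<open>k = b - 1\<close>, which splits the recurrence into two blocks. The formula is then
  propagated downwards in \<open>k\<close> by the recurrence from \<open>k = N + b\<close>, where it is Lagrange interpolation on
  the \<open>N + b + 1\<close> points of the support. The dependence on \<open>M\<close> is matched because the difference of the
  two Hahn terms in \<open>T\<close> vanishes at \<open>k = 0\<close> and is therefore proportional to \<open>q k\<close> at the node.
\<close>

section \<open>Hahn polynomials\<close>

lemma pochhammer_of_nat_Suc: "pochhammer (of_nat m + 1 :: complex) k = fact (m + k) / fact m"
proof -
  have "fact (m + k) = fact m * pochhammer (1 + of_nat m :: complex) k"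
    unfolding pochhammer_fact by (rule pochhammer_product')
  then show ?thesis by (simp add: add.commute)
qed

lemma pochhammer_minus_of_nat:
  assumes "k \<le> m"
  shows "pochhammer (- of_nat m :: complex) k = (- 1) ^ k * fact m / fact (m - k)"
proof -
  have "of_nat m - of_nat k + 1 = (of_nat (m - k) + 1 :: complex)"
    using assms by (simp add: of_nat_diff)
  then show ?thesis
    unfolding pochhammer_minus using assms by (simp only: pochhammer_of_nat_Suc) simp
qed

text \<open>Chu-Vandermonde. Reversing \<open>pochhammer (C + of_nat j) (n - j)\<close> turns it, up
  to sign, into a Pochhammer symbol that starts at \<open>1 - C - of_nat n\<close> for every j, and
  the binomial theorem for Pochhammer symbols applies.\<close>

lemma pochhammer_Vandermonde:
  fixes B C :: complex
  shows "(\<Sum>j\<le>n. pochhammer (- of_nat n) j * pochhammer B j * pochhammer (C + of_nat j) (n - j) / fact j)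
    = pochhammer (C - B) n"
proof -
  have "pochhammer (- of_nat n) j * pochhammer B j * pochhammer (C + of_nat j) (n - j) / fact j
      = (- 1) ^ n * (of_nat (n choose j) * pochhammer B j * pochhammer (1 - C - of_nat n) (n - j))"
    if "j \<le> n" for j
  proof -
    have "of_nat (n choose j) = (- 1) ^ j * pochhammer (- of_nat n :: complex) j / fact j"
      by (simp add: binomial_gbinomial gbinomial_pochhammer)
    moreover have "pochhammer (1 - C - of_nat n) (n - j) = (- 1) ^ (n - j) * pochhammer (C + of_nat j) (n - j)"
      using pochhammer_minus[of "C + of_nat n - 1" "n - j"] that
      by (simp add: algebra_simps of_nat_diff)
    moreover have "(- 1 :: complex) ^ n = (- 1) ^ j * (- 1) ^ (n - j)"
      using that by (simp flip: power_add)
    ultimately show ?thesis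
      by (simp add: minus_one_power_iff)
  qed
  then have "(\<Sum>j\<le>n. pochhammer (- of_nat n) j * pochhammer B j * pochhammer (C + of_nat j) (n - j) / fact j)
      = (- 1) ^ n * pochhammer (B + (1 - C - of_nat n)) n"
    by (subst pochhammer_binomial_sum, subst sum_distrib_left, intro sum.cong) auto
  also have "B + (1 - C - of_nat n) = - (C - B + of_nat n - 1)"
    by simp
  also have "(- 1) ^ n * pochhammer (- (C - B + of_nat n - 1)) n = pochhammer (C - B) n"
    unfolding pochhammer_minus by (simp add: minus_one_power_iff)
  finally show ?thesis .
qed

text \<open>On the basis \<open>pochhammer (- x) j\<close> the Hahn difference operator is
  bidiagonal, which reduces its eigenvalue equation to a two-term recursion for
  coefficients.\<close>

lemma hahn_operator_pochhammer:
  fixes \<alpha> \<beta> N x :: complex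
  shows "(x + \<alpha> + 1) * (x - N) * (pochhammer (- (x + 1)) j - pochhammer (- x) j)
      + x * (x - \<beta> - N - 1) * (pochhammer (- (x - 1)) j - pochhammer (- x) j)
    = of_nat j * (of_nat j + \<alpha> + \<beta> + 1) * pochhammer (- x) j
      - of_nat j * (of_nat j + \<alpha>) * (of_nat j - 1 - N) * pochhammer (- x) (j - 1)"
proof (cases j)
  case (Suc i)
  define p where "p = pochhammer (- x) i"
  define r where "r = pochhammer (1 - x) i"
  have a: "pochhammer (- x) j = p * (of_nat i - x)"
    by (simp add: Suc pochhammer_Suc p_def)
  have b: "pochhammer (- (x + 1)) j = - (x + 1) * p"
    by (simp add: Suc pochhammer_rec p_def)
  \<comment> \<open>Peeling the first or the last factor off \<open>pochhammer (- x) (Suc i)\<close>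
    gives two forms of one product. The operator contains \<open>r\<close> only together with
    \<open>x\<close>, so \<open>r\<close> can be eliminated.\<close>
  have r: "x * r = - (p * (of_nat i - x))"
    using pochhammer_rec[of "- x" i] a by (simp add: r_def Suc) (metis add.inverse_inverse)
  have c: "pochhammer (- (x - 1)) j = r * (of_nat i + 1 - x)"
    by (simp add: Suc pochhammer_Suc r_def algebra_simps)
  have d: "pochhammer (- x) (j - 1) = p"
    by (simp add: Suc p_def)
  have e: "x * (x - \<beta> - N - 1) * (r * (of_nat i + 1 - x) - p * (of_nat i - x))
      = (x - \<beta> - N - 1) * (- (p * (of_nat i - x)) * (of_nat i + 1 - x) - x * (p * (of_nat i - x)))"
    unfolding r[symmetric] by (simp add: algebra_simps)
  have f: "of_nat j = of_nat i + (1::complex)"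
    by (simp add: Suc)
  show ?thesis
    unfolding a b c d e f by (simp add: algebra_simps)
qed simp

text \<open>Coefficients are compared in the basis \<open>pochhammer (- x) j\<close>; the eigenvalue
  is the diagonal entry of the operator at j = n.\<close>

lemma hahn_difference_equation:
  "(x + \<alpha> + 1) * (x - N) * (hahn n \<alpha> \<beta> N (x + 1) - hahn n \<alpha> \<beta> N x)
      + x * (x - \<beta> - N - 1) * (hahn n \<alpha> \<beta> N (x - 1) - hahn n \<alpha> \<beta> N x)
    = of_nat n * (of_nat n + \<alpha> + \<beta> + 1) * hahn n \<alpha> \<beta> N x"
proof -
  define c where "c j = pochhammer (- of_nat n) j * pochhammer (\<alpha> + \<beta> + of_nat n + 1) j
        * pochhammer (- N + of_nat j) (n - j) * pochhammer (\<alpha> + of_nat j + 1) (n - j) / fact j" for j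
  define e where "e = of_nat n * (of_nat n + \<alpha> + \<beta> + 1)"
  have h: "hahn n \<alpha> \<beta> N y = (\<Sum>j\<le>n. c j * pochhammer (- y) j)" for y
    by (simp add: hahn_def c_def)
  have step: "c (Suc j) * (of_nat (Suc j) * (of_nat (Suc j) + \<alpha>) * (of_nat (Suc j) - 1 - N))
      = c j * (of_nat j * (of_nat j + \<alpha> + \<beta> + 1) - e)" if jn: "j < n" for j
  proof -
    obtain m where m: "n = j + Suc m"
      using less_imp_Suc_add[OF jn] by auto
    define A where "A = pochhammer (- of_nat n :: complex) j * pochhammer (\<alpha> + \<beta> + of_nat n + 1) j
      * pochhammer (- N + of_nat (Suc j)) m * pochhammer (\<alpha> + of_nat (Suc j) + 1) m / fact j"
    have nj: "n - j = Suc m" "n - Suc j = m"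
      using m by auto
    have sh: "- N + of_nat j + 1 = - N + of_nat (Suc j)" "\<alpha> + of_nat j + 1 + 1 = \<alpha> + of_nat (Suc j) + 1"
      by simp_all
    have nz: "(of_nat (Suc j) :: complex) \<noteq> 0" "(fact j :: complex) \<noteq> 0"
      by (simp_all del: of_nat_Suc)
    have c1: "c (Suc j) * of_nat (Suc j)
        = A * ((- of_nat n + of_nat j) * (\<alpha> + \<beta> + of_nat n + 1 + of_nat j))"
      unfolding c_def A_def nj pochhammer_Suc fact_Suc using nz by (simp add: field_simps del: of_nat_Suc)
    have c2: "c j = A * ((- N + of_nat j) * (\<alpha> + of_nat j + 1))"
      unfolding c_def A_def nj pochhammer_rec sh by (simp del: of_nat_Suc)
    have "c (Suc j) * (of_nat (Suc j) * (of_nat (Suc j) + \<alpha>) * (of_nat (Suc j) - 1 - N))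
        = c (Suc j) * of_nat (Suc j) * ((of_nat (Suc j) + \<alpha>) * (of_nat (Suc j) - 1 - N))"
      by (simp only: mult.assoc)
    also have "\<dots> = c j * (of_nat j * (of_nat j + \<alpha> + \<beta> + 1) - e)"
      unfolding c1 c2 e_def by (simp add: algebra_simps)
    finally show ?thesis .
  qed
  have "hahn n \<alpha> \<beta> N (x + 1) - hahn n \<alpha> \<beta> N x
      = (\<Sum>j\<le>n. c j * (pochhammer (- (x + 1)) j - pochhammer (- x) j))"
    "hahn n \<alpha> \<beta> N (x - 1) - hahn n \<alpha> \<beta> N x
      = (\<Sum>j\<le>n. c j * (pochhammer (- (x - 1)) j - pochhammer (- x) j))"
    unfolding h by (simp_all only: right_diff_distrib sum_subtractf)
  then have "(x + \<alpha> + 1) * (x - N) * (hahn n \<alpha> \<beta> N (x + 1) - hahn n \<alpha> \<beta> N x)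
      + x * (x - \<beta> - N - 1) * (hahn n \<alpha> \<beta> N (x - 1) - hahn n \<alpha> \<beta> N x)
    = (\<Sum>j\<le>n. c j * ((x + \<alpha> + 1) * (x - N) * (pochhammer (- (x + 1)) j - pochhammer (- x) j)
      + x * (x - \<beta> - N - 1) * (pochhammer (- (x - 1)) j - pochhammer (- x) j)))"
    by (simp only: sum_distrib_left distrib_left sum.distrib mult.left_commute)
  also have "\<dots> = (\<Sum>j\<le>n. c j * (of_nat j * (of_nat j + \<alpha> + \<beta> + 1)) * pochhammer (- x) j)
      - (\<Sum>j\<le>n. c j * (of_nat j * (of_nat j + \<alpha>) * (of_nat j - 1 - N)) * pochhammer (- x) (j - 1))"
    unfolding hahn_operator_pochhammer by (simp only: right_diff_distrib[of "c _"] sum_subtractf mult.assoc)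
  also have "(\<Sum>j\<le>n. c j * (of_nat j * (of_nat j + \<alpha>) * (of_nat j - 1 - N)) * pochhammer (- x) (j - 1))
      = (\<Sum>j<n. c (Suc j) * (of_nat (Suc j) * (of_nat (Suc j) + \<alpha>) * (of_nat (Suc j) - 1 - N)) * pochhammer (- x) j)"
    by (subst sum.atMost_shift) (simp del: of_nat_Suc)
  also have "\<dots> = (\<Sum>j<n. c j * (of_nat j * (of_nat j + \<alpha> + \<beta> + 1) - e) * pochhammer (- x) j)"
    by (intro sum.cong refl) (simp only: step lessThan_iff)
  \<comment> \<open>The added term j = n is zero because \<open>e\<close> is the diagonal entry at j
    = n.\<close>
  also have "\<dots> = (\<Sum>j\<le>n. c j * (of_nat j * (of_nat j + \<alpha> + \<beta> + 1) - e) * pochhammer (- x) j)"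
    by (simp add: lessThan_Suc_atMost[symmetric] e_def)
  also have "(\<Sum>j\<le>n. c j * (of_nat j * (of_nat j + \<alpha> + \<beta> + 1)) * pochhammer (- x) j) - \<dots>
      = (\<Sum>j\<le>n. e * (c j * pochhammer (- x) j))"
    unfolding sum_subtractf[symmetric] by (intro sum.cong refl) (simp add: algebra_simps)
  finally show ?thesis
    by (simp only: h sum_distrib_left e_def)
qed

section \<open>Dual Hahn polynomials\<close>

text \<open>The coefficient of the j-th product once
  \<open>pochhammer (- of_nat n) j / (fact n * (-1) ^ j)\<close> has become
  \<open>1 / fact (n - j)\<close>. The value 0 beyond n lets different degrees be summed over one
  range.\<close>

definition dual_hahn_coeff :: "complex \<Rightarrow> complex \<Rightarrow> nat \<Rightarrow> nat \<Rightarrow> complex" where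
  "dual_hahn_coeff a N n j = (if j \<le> n
     then pochhammer (- N + of_nat j) (n - j) * pochhammer (a + of_nat j + 1) (n - j) / (fact (n - j) * fact j)
     else 0)"

lemma poly_dual_hahn:
  "poly (dual_hahn (int n) a b N) t
    = (\<Sum>j\<le>n. dual_hahn_coeff a N n j * (\<Prod>i<j. t - of_nat i * (a + b + 1 + of_nat i)))"
proof -
  have "pochhammer (- of_nat n :: complex) j / (fact n * (-1) ^ j) = 1 / fact (n - j)" if "j \<le> n" for j
    using that by (simp add: pochhammer_minus_of_nat)
  then have "pochhammer (- of_nat n) j * pochhammer (- N + of_nat j) (n - j) * pochhammer (a + of_nat j + 1) (n - j)
      / (fact n * (-1) ^ j * fact j) = dual_hahn_coeff a N n j" if "j \<le> n" for j
    using that by (simp add: dual_hahn_coeff_def divide_simps)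
  then show ?thesis
    by (simp add: dual_hahn_def poly_sum poly_prod)
qed

text \<open>The three-term recurrence read off coefficientwise; the left side is multiplication by
  the variable in the basis of products.\<close>

lemma dual_hahn_coeff_recurrence:
  assumes "j \<le> Suc n"
  shows "(if j = 0 then 0 else dual_hahn_coeff a N n (j - 1))
      + of_nat j * (a + b + 1 + of_nat j) * dual_hahn_coeff a N n j
    = of_nat (Suc n) * dual_hahn_coeff a N (Suc n) j
      - ((of_nat n + a + 1) * (of_nat n - N) + of_nat n * (of_nat n - b - N - 1)) * dual_hahn_coeff a N n j
      + (of_nat n + a) * (of_nat n - 1 - N) * (of_nat n - b - N - 1)
        * (if n = 0 then 0 else dual_hahn_coeff a N (n - 1) j)"
proof -
  consider "j = Suc n" | "j = n" | "j < n" using assms by linarith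
  then show ?thesis
  proof cases
    case 1
    then show ?thesis by (auto simp: dual_hahn_coeff_def simp del: of_nat_Suc)
  next
    case 2
    show ?thesis
    proof (cases n)
      case 0
      then show ?thesis by (simp add: 2 dual_hahn_coeff_def algebra_simps)
    next
      case (Suc k)
      have "(fact k :: complex) \<noteq> 0" "(1 + of_nat k :: complex) \<noteq> 0"
        by (simp, metis of_nat_Suc of_nat_eq_0_iff nat.distinct(1))
      then show ?thesis
        by (simp add: 2 Suc dual_hahn_coeff_def divide_simps) (simp add: algebra_simps)
    qed
  next
    case 3
    obtain m where n: "n = Suc (j + m)"
      using less_imp_Suc_add[OF 3] by auto
    define \<mu> where "\<mu> = (of_nat m :: complex)"
    define J where "J = (of_nat j :: complex)"
    define u v where "u = - N + J + \<mu>" and "v = a + J + 1 + \<mu>"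
    \<comment> \<open>A common divisor of all four coefficients: the one of degree n - 1 divided by
      \<open>(\<mu> + 1) * (\<mu> + 2)\<close>, so that each is \<open>K\<close> times a
      polynomial.\<close>
    define K where "K = pochhammer (- N + J) m * pochhammer (a + J + 1) m / (fact (m + 2) * fact j)"
    have nz: "\<mu> + 1 \<noteq> 0" "\<mu> + 2 \<noteq> 0"
      unfolding \<mu>_def by (metis Suc_eq_plus1 nat.distinct(1) of_nat_1 of_nat_add of_nat_eq_0_iff,
        metis add_2_eq_Suc' nat.distinct(1) of_nat_add of_nat_eq_0_iff of_nat_numeral)
    have f2: "(fact (m + 2) :: complex) = (\<mu> + 2) * ((\<mu> + 1) * fact m)"
      and f1: "(fact (m + 1) :: complex) = (\<mu> + 1) * fact m"
      by (simp_all add: \<mu>_def algebra_simps)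
    have c0: "dual_hahn_coeff a N (n - 1) j = K * ((\<mu> + 1) * (\<mu> + 2))"
      unfolding dual_hahn_coeff_def K_def f2 using nz by (simp add: n J_def)
    have c1: "dual_hahn_coeff a N n j = K * ((\<mu> + 2) * u * v)"
    proof -
      have "n - j = m + 1" using n by simp
      then show ?thesis
        unfolding dual_hahn_coeff_def K_def f2 u_def v_def using nz
        by (simp add: f1 pochhammer_Suc del: fact_Suc) (simp add: n J_def \<mu>_def add_ac mult_ac)
    qed
    have c2: "dual_hahn_coeff a N (Suc n) j = K * (u * (u + 1) * v * (v + 1))"
    proof -
      have "Suc n - j = m + 2" "j \<le> Suc n" using n by simp_all
      then show ?thesis
        unfolding dual_hahn_coeff_def K_def u_def v_def
        by (simp add: numeral_2_eq_2 pochhammer_Suc J_def \<mu>_def add_ac del: fact_Suc)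
    qed
    have s: "(if j = 0 then 0 else dual_hahn_coeff a N n (j - 1)) = K * (J * (- N + J - 1) * (a + J) * u * v)"
    proof (cases j)
      case 0
      then show ?thesis by (simp add: J_def)
    next
      case (Suc i)
      have ni: "n - i = m + 2" "i \<le> n" using n Suc by simp_all
      have J: "J = of_nat i + 1" "fact j = J * fact i" "J \<noteq> 0"
        by (simp_all add: J_def Suc del: of_nat_Suc) simp
      have ph: "pochhammer x (m + 2) = x * (pochhammer (x + 1) m * (x + 1 + of_nat m))" for x :: complex
        unfolding numeral_2_eq_2 add_Suc_right add_0_right
        by (subst pochhammer_rec) (simp only: pochhammer_Suc)
      have sh: "- N + of_nat i + 1 = - N + J" "a + of_nat i + 1 + 1 = a + J + 1" "a + of_nat i + 1 = a + J"
        "- N + of_nat i = - N + J - 1"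
        using J(1) by simp_all
      have p1: "pochhammer (- N + of_nat i) (m + 2) = (- N + J - 1) * (pochhammer (- N + J) m * u)"
        unfolding ph sh(1) u_def \<mu>_def by (simp only: sh(4))
      have p2: "pochhammer (a + of_nat i + 1) (m + 2) = (a + J) * (pochhammer (a + J + 1) m * v)"
        unfolding ph sh(2) v_def \<mu>_def by (simp only: sh(3))
      have "dual_hahn_coeff a N n i = (- N + J - 1) * (pochhammer (- N + J) m * u)
          * ((a + J) * (pochhammer (a + J + 1) m * v)) / (fact (m + 2) * fact i)"
        by (simp only: dual_hahn_coeff_def ni if_True p1 p2)
      then show ?thesis
        unfolding K_def J(2) using J(3) by (simp add: Suc del: fact_Suc)
    qed
    have n0: "n \<noteq> 0" and Sn: "(of_nat (Suc n) :: complex) = J + \<mu> + 2"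
      by (simp_all add: n J_def \<mu>_def)
    have nn: "of_nat n = J + \<mu> + 1"
      by (simp_all add: n J_def \<mu>_def)
    have sh: "- N + J - 1 = u - \<mu> - 1" "a + J = v - 1 - \<mu>" "a + b + 1 + J = v - \<mu> + b"
      "J + \<mu> + 1 + a + 1 = v + 1" "J + \<mu> + 1 - N = u + 1" "J + \<mu> + 1 - b - N - 1 = u - b"
      "J + \<mu> + 1 + a = v" "J + \<mu> + 1 - 1 - N = u"
      by (simp_all add: u_def v_def)
    \<comment> \<open>What is left once the factor \<open>K * u * v\<close> is removed from every
      term.\<close>
    have "J * (u - \<mu> - 1) * (v - 1 - \<mu>) + J * (v - \<mu> + b) * (\<mu> + 2)
        = (J + \<mu> + 2) * ((u + 1) * (v + 1)) - ((v + 1) * (u + 1) + (J + \<mu> + 1) * (u - b)) * (\<mu> + 2)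
          + (u - b) * ((\<mu> + 1) * (\<mu> + 2))"
      by (simp add: algebra_simps)
    from arg_cong[OF this, of "\<lambda>x. (K * u * v) * x",
        unfolded distrib_left[of "K * u * v"] right_diff_distrib[of "K * u * v"]] show ?thesis
      unfolding s c0 c1 c2 J_def[symmetric] Sn nn sh if_not_P[OF n0]
      by (simp only: mult_ac)
  qed
qed

lemma dual_hahn_recurrence:
  "t * poly (dual_hahn (int n) a b N) t
    = of_nat (Suc n) * poly (dual_hahn (int (Suc n)) a b N) t
      - ((of_nat n + a + 1) * (of_nat n - N) + of_nat n * (of_nat n - b - N - 1)) * poly (dual_hahn (int n) a b N) t
      + (of_nat n + a) * (of_nat n - 1 - N) * (of_nat n - b - N - 1) * poly (dual_hahn (int n - 1) a b N) t"
proof -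
  define \<pi> where "\<pi> j = (\<Prod>i<j. t - of_nat i * (a + b + 1 + of_nat i))" for j
  let ?r = "dual_hahn_coeff a N"
  have ev: "poly (dual_hahn (int k) a b N) t = (\<Sum>j\<le>k. ?r k j * \<pi> j)" for k
    by (simp add: poly_dual_hahn \<pi>_def)
  have z: "?r k j = 0" if "j > k" for k j
    using that by (simp add: dual_hahn_coeff_def)
  have ext: "(\<Sum>j\<le>k. ?r k j * \<pi> j) = (\<Sum>j\<le>Suc n. ?r k j * \<pi> j)" if "k \<le> Suc n" for k
    using that by (intro sum.mono_neutral_left) (auto simp: z)
  have R0: "poly (dual_hahn (int n) a b N) t = (\<Sum>j\<le>Suc n. ?r n j * \<pi> j)"
    and R1: "poly (dual_hahn (int (Suc n)) a b N) t = (\<Sum>j\<le>Suc n. ?r (Suc n) j * \<pi> j)"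
    unfolding ev by (rule ext, simp)+
  \<comment> \<open>For n = 0 the index \<open>int n - 1\<close> is negative and the polynomial is 0
    by convention.\<close>
  have Rm: "poly (dual_hahn (int n - 1) a b N) t
      = (\<Sum>j\<le>Suc n. (if n = 0 then 0 else ?r (n - 1) j) * \<pi> j)"
  proof (cases n)
    case 0
    then show ?thesis by (simp add: dual_hahn_def)
  next
    case (Suc m)
    then have "int n - 1 = int m" "n - 1 = m" "n \<noteq> 0" by simp_all
    then show ?thesis
      by (simp only: ev if_False) (rule ext, simp add: Suc)
  qed
  \<comment> \<open>Multiplication by \<open>t\<close> is bidiagonal on the products:
    \<open>t\<close> is the next factor plus the constant subtracted in it.\<close>
  have \<pi>: "t * \<pi> j = \<pi> (Suc j) + of_nat j * (a + b + 1 + of_nat j) * \<pi> j" for j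
    by (simp add: \<pi>_def algebra_simps)
  have "t * poly (dual_hahn (int n) a b N) t
      = (\<Sum>j\<le>n. ?r n j * \<pi> (Suc j)) + (\<Sum>j\<le>n. of_nat j * (a + b + 1 + of_nat j) * ?r n j * \<pi> j)"
    unfolding ev sum_distrib_left sum.distrib[symmetric]
    by (intro sum.cong refl) (simp only: mult.left_commute[of t] \<pi>, simp add: algebra_simps)
  also have "(\<Sum>j\<le>n. ?r n j * \<pi> (Suc j)) = (\<Sum>j\<le>Suc n. (if j = 0 then 0 else ?r n (j - 1)) * \<pi> j)"
    unfolding sum.atMost_Suc_shift by simp
  also have "(\<Sum>j\<le>n. of_nat j * (a + b + 1 + of_nat j) * ?r n j * \<pi> j)
      = (\<Sum>j\<le>Suc n. of_nat j * (a + b + 1 + of_nat j) * ?r n j * \<pi> j)"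
    by (simp add: z)
  also have "(\<Sum>j\<le>Suc n. (if j = 0 then 0 else ?r n (j - 1)) * \<pi> j) + \<dots>
    = (\<Sum>j\<le>Suc n. ((if j = 0 then 0 else ?r n (j - 1)) + of_nat j * (a + b + 1 + of_nat j) * ?r n j) * \<pi> j)"
    by (simp only: sum.distrib distrib_right)
  also have "\<dots> = (\<Sum>j\<le>Suc n. (of_nat (Suc n) * ?r (Suc n) j
      - ((of_nat n + a + 1) * (of_nat n - N) + of_nat n * (of_nat n - b - N - 1)) * ?r n j
      + (of_nat n + a) * (of_nat n - 1 - N) * (of_nat n - b - N - 1)
        * (if n = 0 then 0 else ?r (n - 1) j)) * \<pi> j)"
    by (intro sum.cong refl) (simp only: dual_hahn_coeff_recurrence atMost_iff)
  finally show ?thesis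
    unfolding R0 R1 Rm sum_distrib_left
    by (simp only: sum.distrib sum_subtractf distrib_right left_diff_distrib mult.assoc)
qed

section \<open>The recurrence shifted by b, and its solutions\<close>

locale dual_hahn_parameters =
  fixes a b N :: nat
  assumes b_pos: "1 \<le> b" and b_le_a: "b \<le> a"
begin

text \<open>Numbers the support points \<lambda>(-b), ..., \<lambda>(N) from 0 to N + b; the first b
  of them carry the free masses.\<close>

definition node :: "nat \<Rightarrow> complex" where
  "node X = lambda_ab a b (of_nat X - of_nat b)"

definition q :: "nat \<Rightarrow> complex poly" where
  "q k = dual_hahn (int k - int b) (of_nat b) (of_nat a) (of_nat N)"

definition rec_diag :: "nat \<Rightarrow> complex" where
  "rec_diag k = - ((of_nat k + 1) * (of_nat k - of_nat b - of_nat N)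
     + (of_nat k - of_nat b) * (of_nat k - of_nat b - of_nat a - of_nat N - 1))"

definition rec_low :: "nat \<Rightarrow> complex" where
  "rec_low k = of_nat k * (of_nat k - of_nat b - 1 - of_nat N) * (of_nat k - of_nat b - of_nat a - of_nat N - 1)"

text \<open>The three-term recurrence of the dual Hahn polynomials with the degree shifted by \<open>b\<close>; the
  coefficient \<open>rec_low 0 = 0\<close> makes the junk index \<open>0 - 1\<close> harmless.\<close>

definition dual_hahn_rec :: "complex \<Rightarrow> (nat \<Rightarrow> complex) \<Rightarrow> bool" where
  "dual_hahn_rec z f \<longleftrightarrow> (\<forall>k. z * f k
     = (of_nat k + 1 - of_nat b) * f (Suc k) + rec_diag k * f k + rec_low k * f (k - 1))"

lemma q_low: "k < b \<Longrightarrow> q k = 0"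
  by (simp add: q_def dual_hahn_def)

lemma q_rec: "dual_hahn_rec t (\<lambda>k. poly (q k) t)"
  unfolding dual_hahn_rec_def
proof
  fix k
  show "t * poly (q k) t
     = (of_nat k + 1 - of_nat b) * poly (q (Suc k)) t + rec_diag k * poly (q k) t + rec_low k * poly (q (k - 1)) t"
  proof (cases "k < b")
    case True
    \<comment> \<open>At k = b - 1 the next polynomial \<open>q b\<close> is 1 and it is the
      coefficient that vanishes; for smaller k the next polynomial is 0.\<close>
    then have "of_nat k + 1 - of_nat b = (0::complex) \<or> q (Suc k) = 0"
      by (cases "Suc k = b") (auto simp: q_low)
    moreover have "q k = 0" "q (k - 1) = 0" using True by (auto simp: q_low)
    ultimately show ?thesis by auto
  next
    case False
    define n where "n = k - b"
    have k: "int k - int b = int n" "int (Suc k) - int b = int (Suc n)" "int (k - 1) - int b = int n - 1"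
      and kn: "k = n + b" "(of_nat k :: complex) = of_nat n + of_nat b"
      using False b_pos by (simp_all add: n_def of_nat_diff)
    show ?thesis
      unfolding q_def k rec_diag_def rec_low_def kn(2)
      using dual_hahn_recurrence[of t n "of_nat b" "of_nat a" "of_nat N"]
      by (simp add: algebra_simps)
  qed
qed

text \<open>The recurrence determines \<open>f (Suc m)\<close> from earlier values except when
  \<open>Suc m = b\<close>, where its coefficient is 0. The free initial values are therefore those
  at 0 and b.\<close>

lemma dual_hahn_rec_unique:
  assumes rec: "dual_hahn_rec z f" and f0: "f 0 = 0" and fb: "f b = 0"
  shows "f k = 0"
proof (induction k rule: less_induct)
  case (less k)
  show ?case
  proof (cases k)
    case 0
    then show ?thesis using f0 by simp
  next
    case (Suc m)
    show ?thesis
    proof (cases "k = b")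
      case False
      have "f m = 0" "f (m - 1) = 0" using less Suc by auto
      then have "(of_nat m + 1 - of_nat b) * f k = 0"
        using rec Suc unfolding dual_hahn_rec_def by (metis add_0_right mult_zero_right)
      moreover have "of_nat m + 1 - of_nat b \<noteq> (0::complex)"
        using False Suc by (metis of_nat_Suc of_nat_eq_iff add.commute right_minus_eq)
      ultimately show ?thesis by simp
    qed (use fb in simp)
  qed
qed

lemma dual_hahn_rec_combination:
  assumes "dual_hahn_rec z f" and "dual_hahn_rec z g"
  shows "dual_hahn_rec z (\<lambda>k. c * f k + d * g k)"
  unfolding dual_hahn_rec_def
proof
  fix k
  have "z * (c * f k + d * g k) = c * (z * f k) + d * (z * g k)"
    by (simp add: algebra_simps)
  also have "z * f k = (of_nat k + 1 - of_nat b) * f (Suc k) + rec_diag k * f k + rec_low k * f (k - 1)"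
    using assms(1) unfolding dual_hahn_rec_def by blast
  also have "z * g k = (of_nat k + 1 - of_nat b) * g (Suc k) + rec_diag k * g k + rec_low k * g (k - 1)"
    using assms(2) unfolding dual_hahn_rec_def by blast
  finally show "z * (c * f k + d * g k) = (of_nat k + 1 - of_nat b) * (c * f (Suc k) + d * g (Suc k))
      + rec_diag k * (c * f k + d * g k) + rec_low k * (c * f (k - 1) + d * g (k - 1))"
    by (simp add: algebra_simps)
qed

text \<open>\<open>q\<close> is the solution with value 0 at 0 and 1 at b, so subtracting
  \<open>f b\<close> times it makes both initial values zero.\<close>

lemma dual_hahn_rec_eq_q:
  assumes rec: "dual_hahn_rec z f" and f0: "f 0 = 0"
  shows "f k = f b * poly (q k) z"
proof -
  have q0: "poly (q 0) z = 0" and qb: "poly (q b) z = 1"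
    using b_pos by (simp_all add: q_low) (simp add: q_def dual_hahn_def)
  have "dual_hahn_rec z (\<lambda>k. 1 * f k + (- f b) * poly (q k) z)"
    using rec q_rec[of z] by (rule dual_hahn_rec_combination)
  from dual_hahn_rec_unique[OF this, of k] show ?thesis
    using f0 q0 qb by simp
qed

text \<open>The two Hahn polynomials in \<open>W_poly\<close>, as functions of the index \<open>k\<close>. By duality the difference
  equation of the Hahn polynomials is the recurrence of the dual Hahn polynomials at a node \<open>i < b\<close>.\<close>

definition F :: "nat \<Rightarrow> nat \<Rightarrow> complex" where
  "F i k = pochhammer (- of_nat N - of_nat a - of_nat b) (k + a)
     * hahn i (of_nat a) (- of_nat b) (of_nat N + of_nat b) (of_nat N + of_nat b - of_nat k)"

definition S :: "nat \<Rightarrow> nat \<Rightarrow> complex" where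
  "S i k = pochhammer (- of_nat N - of_nat a - of_nat b) k
     * hahn (b - i - 1) (- of_nat a) (- of_nat b) (of_nat N + of_nat a + of_nat b)
         (of_nat N + of_nat a + of_nat b - of_nat k)"

lemma F_rec: "dual_hahn_rec (node i) (F i)"
  unfolding dual_hahn_rec_def
proof
  fix k
  define h where "h = hahn i (of_nat a) (- of_nat b) (of_nat N + of_nat b)"
  define x where "x = (of_nat N + of_nat b - of_nat k :: complex)"
  define p where "p = pochhammer (- of_nat N - of_nat a - of_nat b :: complex) (k + a)"
  have F0: "F i k = p * h x"
    by (simp add: F_def p_def h_def x_def)
  have F1: "F i (Suc k) = p * ((of_nat k - of_nat N - of_nat b) * h (x - 1))"
    by (simp add: F_def p_def h_def x_def pochhammer_Suc algebra_simps)
  \<comment> \<open>Multiplying by \<open>rec_low k\<close> supplies the factor by which the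
    Pochhammer symbols at k - 1 and k differ, so nothing is divided; at k = 0 both sides are
    0.\<close>
  have Fm: "rec_low k * F i (k - 1)
      = p * (of_nat k * (of_nat k - of_nat b - of_nat a - of_nat N - 1) * h (x + 1))"
  proof (cases k)
    case (Suc m)
    have "x + 1 = of_nat N + of_nat b - of_nat m"
      by (simp add: x_def Suc)
    then have "F i m = pochhammer (- of_nat N - of_nat a - of_nat b) (m + a) * h (x + 1)"
      by (simp only: F_def h_def)
    moreover have "p = pochhammer (- of_nat N - of_nat a - of_nat b) (m + a) * (of_nat k - of_nat b - 1 - of_nat N)"
      by (simp add: p_def Suc pochhammer_Suc)
    ultimately show ?thesis
      by (simp only: rec_low_def Suc diff_Suc_1 mult_ac)
  qed (simp add: rec_low_def)
  have D: "(x + of_nat a + 1) * (x - (of_nat N + of_nat b)) * (h (x + 1) - h x)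
      + x * (x - (- of_nat b) - (of_nat N + of_nat b) - 1) * (h (x - 1) - h x)
    = of_nat i * (of_nat i + of_nat a + - of_nat b + 1) * h x"
    unfolding h_def by (rule hahn_difference_equation)
  \<comment> \<open>With x = N + b - k the shifts x - 1 and x + 1 are the indices k + 1 and k - 1.
    The eigenvalue exceeds \<open>node i\<close> by b * (a + 1), which \<open>rec_diag\<close>
    absorbs.\<close>
  have "node i * h x - ((of_nat k + 1 - of_nat b) * ((of_nat k - of_nat N - of_nat b) * h (x - 1)) + rec_diag k * h x
        + of_nat k * (of_nat k - of_nat b - of_nat a - of_nat N - 1) * h (x + 1))
      = of_nat i * (of_nat i + of_nat a + - of_nat b + 1) * h x
        - ((x + of_nat a + 1) * (x - (of_nat N + of_nat b)) * (h (x + 1) - h x)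
      + x * (x - (- of_nat b) - (of_nat N + of_nat b) - 1) * (h (x - 1) - h x))"
    by (simp add: node_def lambda_ab_def rec_diag_def) (simp add: x_def algebra_simps)
  then have E: "node i * h x = (of_nat k + 1 - of_nat b) * ((of_nat k - of_nat N - of_nat b) * h (x - 1))
      + rec_diag k * h x + of_nat k * (of_nat k - of_nat b - of_nat a - of_nat N - 1) * h (x + 1)"
    unfolding D by simp
  show "node i * F i k = (of_nat k + 1 - of_nat b) * F i (Suc k) + rec_diag k * F i k + rec_low k * F i (k - 1)"
    unfolding F0 F1 Fm mult.left_commute[of _ p] E by (simp only: distrib_left)
qed

lemma S_rec:
  assumes i: "i < b"
  shows "dual_hahn_rec (node i) (S i)"
  unfolding dual_hahn_rec_def
proof
  fix k
  define h where "h = hahn (b - i - 1) (- of_nat a) (- of_nat b) (of_nat N + of_nat a + of_nat b)"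
  define x where "x = (of_nat N + of_nat a + of_nat b - of_nat k :: complex)"
  define p where "p = pochhammer (- of_nat N - of_nat a - of_nat b :: complex) k"
  have n: "of_nat (b - i - 1) = (of_nat b - of_nat i - 1 :: complex)"
    using i by (simp add: of_nat_diff)
  have F0: "S i k = p * h x"
    by (simp add: S_def p_def h_def x_def)
  have F1: "S i (Suc k) = p * ((of_nat k - of_nat N - of_nat a - of_nat b) * h (x - 1))"
    by (simp add: S_def p_def h_def x_def pochhammer_Suc algebra_simps)
  have Fm: "rec_low k * S i (k - 1)
      = p * (of_nat k * (of_nat k - of_nat b - 1 - of_nat N) * h (x + 1))"
  proof (cases k)
    case (Suc m)
    have "x + 1 = of_nat N + of_nat a + of_nat b - of_nat m"
      by (simp add: x_def Suc)
    then have "S i m = pochhammer (- of_nat N - of_nat a - of_nat b) m * h (x + 1)"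
      by (simp only: S_def h_def)
    moreover have "p = pochhammer (- of_nat N - of_nat a - of_nat b) m * (of_nat k - of_nat b - of_nat a - of_nat N - 1)"
      by (simp add: p_def Suc pochhammer_Suc)
    ultimately show ?thesis
      by (simp only: rec_low_def Suc diff_Suc_1 mult_ac)
  qed (simp add: rec_low_def)
  have D: "(x + - of_nat a + 1) * (x - (of_nat N + of_nat a + of_nat b)) * (h (x + 1) - h x)
      + x * (x - (- of_nat b) - (of_nat N + of_nat a + of_nat b) - 1) * (h (x - 1) - h x)
    = of_nat (b - i - 1) * (of_nat (b - i - 1) + - of_nat a + - of_nat b + 1) * h x"
    unfolding h_def by (rule hahn_difference_equation)
  \<comment> \<open>Here x = N + a + b - k, and the eigenvalue exceeds \<open>node i\<close> by a +
    b.\<close>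
  have "node i * h x - ((of_nat k + 1 - of_nat b) * ((of_nat k - of_nat N - of_nat a - of_nat b) * h (x - 1)) + rec_diag k * h x
        + of_nat k * (of_nat k - of_nat b - 1 - of_nat N) * h (x + 1))
      = of_nat (b - i - 1) * (of_nat (b - i - 1) + - of_nat a + - of_nat b + 1) * h x
        - ((x + - of_nat a + 1) * (x - (of_nat N + of_nat a + of_nat b)) * (h (x + 1) - h x)
      + x * (x - (- of_nat b) - (of_nat N + of_nat a + of_nat b) - 1) * (h (x - 1) - h x))"
    unfolding n by (simp add: node_def lambda_ab_def rec_diag_def) (simp add: x_def algebra_simps)
  then have E: "node i * h x = (of_nat k + 1 - of_nat b) * ((of_nat k - of_nat N - of_nat a - of_nat b) * h (x - 1))
      + rec_diag k * h x + of_nat k * (of_nat k - of_nat b - 1 - of_nat N) * h (x + 1)"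
    unfolding D by simp
  show "node i * S i k = (of_nat k + 1 - of_nat b) * S i (Suc k) + rec_diag k * S i k + rec_low k * S i (k - 1)"
    unfolding F0 F1 Fm mult.left_commute[of _ p] E by (simp only: distrib_left)
qed

end

section \<open>Special values\<close>

text \<open>At x = N the factors in N join to \<open>pochhammer (- N) n\<close>, free of j; what
  remains is a Chu-Vandermonde sum.\<close>

lemma hahn_at_N: "hahn n \<alpha> \<beta> N N = pochhammer (- N) n * pochhammer (- \<beta> - of_nat n) n"
proof -
  have "hahn n \<alpha> \<beta> N N = (\<Sum>j\<le>n. pochhammer (- N) n * (pochhammer (- of_nat n) j
      * pochhammer (\<alpha> + \<beta> + of_nat n + 1) j * pochhammer (\<alpha> + 1 + of_nat j) (n - j) / fact j))"
    unfolding hahn_def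
  proof (intro sum.cong refl)
    fix j assume "j \<in> {..n}"
    then have *: "pochhammer (- N) n = pochhammer (- N) j * pochhammer (- N + of_nat j) (n - j)"
      by (intro pochhammer_product) simp
    have **: "\<alpha> + of_nat j + 1 = \<alpha> + 1 + of_nat j" by simp
    show "pochhammer (- of_nat n) j * pochhammer (\<alpha> + \<beta> + of_nat n + 1) j * pochhammer (- N + of_nat j) (n - j)
        * pochhammer (\<alpha> + of_nat j + 1) (n - j) * pochhammer (- N) j / fact j
      = pochhammer (- N) n * (pochhammer (- of_nat n) j * pochhammer (\<alpha> + \<beta> + of_nat n + 1) j
        * pochhammer (\<alpha> + 1 + of_nat j) (n - j) / fact j)"
      unfolding * ** by simp
  qed
  also have "\<dots> = pochhammer (- N) n * pochhammer (\<alpha> + 1 - (\<alpha> + \<beta> + of_nat n + 1)) n"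
    by (simp only: pochhammer_Vandermonde flip: sum_distrib_left)
  also have "\<alpha> + 1 - (\<alpha> + \<beta> + of_nat n + 1) = - \<beta> - of_nat n"
    by simp
  finally show ?thesis .
qed

text \<open>As at x = N, except that here the factors in \<alpha> + 1 join.\<close>

lemma hahn_at_minus_Suc: "hahn n \<alpha> \<beta> N (- \<alpha> - 1)
    = pochhammer (\<alpha> + 1) n * pochhammer (- N - \<alpha> - \<beta> - of_nat n - 1) n"
proof -
  have "hahn n \<alpha> \<beta> N (- \<alpha> - 1) = (\<Sum>j\<le>n. pochhammer (\<alpha> + 1) n * (pochhammer (- of_nat n) j
      * pochhammer (\<alpha> + \<beta> + of_nat n + 1) j * pochhammer (- N + of_nat j) (n - j) / fact j))"
    unfolding hahn_def
  proof (intro sum.cong refl)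
    fix j assume "j \<in> {..n}"
    then have *: "pochhammer (\<alpha> + 1) n = pochhammer (\<alpha> + 1) j * pochhammer (\<alpha> + 1 + of_nat j) (n - j)"
      by (intro pochhammer_product) simp
    have **: "\<alpha> + of_nat j + 1 = \<alpha> + 1 + of_nat j" "- (- \<alpha> - 1) = \<alpha> + 1" by simp_all
    show "pochhammer (- of_nat n) j * pochhammer (\<alpha> + \<beta> + of_nat n + 1) j * pochhammer (- N + of_nat j) (n - j)
        * pochhammer (\<alpha> + of_nat j + 1) (n - j) * pochhammer (- (- \<alpha> - 1)) j / fact j
      = pochhammer (\<alpha> + 1) n * (pochhammer (- of_nat n) j * pochhammer (\<alpha> + \<beta> + of_nat n + 1) j
        * pochhammer (- N + of_nat j) (n - j) / fact j)"
      unfolding * ** by simp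
  qed
  also have "\<dots> = pochhammer (\<alpha> + 1) n * pochhammer (- N - (\<alpha> + \<beta> + of_nat n + 1)) n"
    by (simp only: pochhammer_Vandermonde flip: sum_distrib_left)
  also have "- N - (\<alpha> + \<beta> + of_nat n + 1) = - N - \<alpha> - \<beta> - of_nat n - 1"
    by simp
  finally show ?thesis .
qed

lemma hahn_at_0: "hahn n \<alpha> \<beta> N 0 = pochhammer (- N) n * pochhammer (\<alpha> + 1) n"
proof -
  have "hahn n \<alpha> \<beta> N 0 = (\<Sum>j\<in>{0}. pochhammer (- of_nat n) j * pochhammer (\<alpha> + \<beta> + of_nat n + 1) j
        * pochhammer (- N + of_nat j) (n - j) * pochhammer (\<alpha> + of_nat j + 1) (n - j)
        * pochhammer (- 0) j / fact j)"
    unfolding hahn_def by (rule sum.mono_neutral_right) (auto simp: pochhammer_0_left)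
  then show ?thesis by simp
qed

lemma degree_prod_linear_le: "degree (\<Prod>i<j. [: - f i, 1 :] :: complex poly) = j"
  by (subst degree_prod_eq_sum_degree) auto

lemma degree_dual_hahn_le: "degree (dual_hahn (int n) a b N) \<le> n"
  unfolding dual_hahn_def Let_def
  by (simp, intro degree_sum_le ballI order.trans[OF degree_smult_le]) (simp_all add: degree_prod_linear_le)

lemma coeff_dual_hahn: "coeff (dual_hahn (int n) a b N) n = 1 / fact n"
proof -
  let ?p = "\<lambda>j. \<Prod>i<j. [: - (of_nat i * (a + b + 1 + of_nat i)), 1 :] :: complex poly"
  have z: "coeff (?p j) n = (if j = n then 1 else 0)" if "j \<le> n" for j
  proof (cases "j = n")
    case True
    have "lead_coeff (?p j) = 1" by (subst lead_coeff_prod) auto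
    then show ?thesis using True by (simp add: degree_prod_linear_le)
  next
    case False
    then show ?thesis using that by (simp add: coeff_eq_0 degree_prod_linear_le)
  qed
  let ?c = "\<lambda>j. pochhammer (- of_nat n) j * pochhammer (- N + of_nat j) (n - j)
            * pochhammer (a + of_nat j + 1) (n - j) / (fact n * (-1) ^ j * fact j)"
  have "coeff (dual_hahn (int n) a b N) n = (\<Sum>j\<le>n. ?c j * (if j = n then 1 else 0))"
    unfolding dual_hahn_def Let_def by (simp add: coeff_sum) (intro sum.cong refl, simp add: z)
  also have "\<dots> = (\<Sum>j\<in>{n}. ?c j * (if j = n then 1 else 0))"
    by (rule sum.mono_neutral_right) auto
  also have "\<dots> = ?c n" by simp
  also have "\<dots> = 1 / fact n"
    by (simp add: pochhammer_same field_simps)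
  finally show ?thesis .
qed

context dual_hahn_parameters
begin

section \<open>Nodes, Lagrange weights and values of the dual Hahn polynomials at the nodes\<close>

lemma node_diff: "node X - node Y = (of_nat X - of_nat Y) * (of_nat X + of_nat Y + of_nat (a - b) + 1)"
  using b_le_a by (simp add: node_def lambda_ab_def of_nat_diff algebra_simps)

lemma node_add_b: "node (b + x) = of_nat x * (of_nat b + of_nat a + 1 + of_nat x)"
  by (simp add: node_def lambda_ab_def algebra_simps)

lemma node_eq_iff: "node X = node Y \<longleftrightarrow> X = Y"
proof -
  have "(of_nat X + of_nat Y + of_nat (a - b) + 1 :: complex) = of_nat (X + Y + (a - b) + 1)"
    by simp
  then have "of_nat X + of_nat Y + of_nat (a - b) + 1 \<noteq> (0 :: complex)"
    by (metis add_is_0 of_nat_eq_0_iff one_neq_zero)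
  then show ?thesis
    using node_diff[of X Y] by auto
qed

text \<open>For X \<le> N + b, the derivative at \<open>node X\<close> of the monic polynomial whose
  roots are the N + b + 1 nodes, that is, the Lagrange denominator.\<close>

definition weight :: "nat \<Rightarrow> complex" where
  "weight X = (\<Prod>Y\<in>{..N + b} - {X}. node X - node Y)"

lemma weight_nonzero: "weight X \<noteq> 0"
  by (simp add: weight_def node_eq_iff)

lemma (in -) prod_nat_diff:
  assumes "X \<le> P"
  shows "(\<Prod>Y\<in>{..P} - {X}. of_nat X - of_nat Y :: complex) = (- 1) ^ (P - X) * fact X * fact (P - X)"
proof -
  have split: "{..P} - {X} = {..<X} \<union> {X<..P}" using assms by auto
  have "(\<Prod>Y\<in>{..P} - {X}. of_nat X - of_nat Y :: complex)
      = (\<Prod>Y<X. of_nat X - of_nat Y) * (\<Prod>Y\<in>{X<..P}. of_nat X - of_nat Y)"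
    unfolding split by (rule prod.union_disjoint) auto
  also have "(\<Prod>Y<X. of_nat X - of_nat Y :: complex) = (\<Prod>Y\<in>{1..X}. of_nat Y)"
    by (rule prod.reindex_bij_witness[of _ "\<lambda>Y. X - Y" "\<lambda>Y. X - Y"]) (auto simp: of_nat_diff)
  also have "\<dots> = fact X" by (simp add: fact_prod)
  also have "(\<Prod>Y\<in>{X<..P}. of_nat X - of_nat Y :: complex) = (\<Prod>Y\<in>{1..P - X}. - of_nat Y)"
    by (rule prod.reindex_bij_witness[of _ "\<lambda>Y. X + Y" "\<lambda>Y. Y - X"]) (auto simp: of_nat_diff)
  also have "\<dots> = (- 1) ^ (P - X) * fact (P - X)"
    by (simp add: fact_prod prod_uminus)
  finally show ?thesis by (simp add: mult_ac)
qed

lemma weight_eq: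
  assumes "X \<le> N + b"
  shows "weight X = (- 1) ^ (N + b - X) * fact X * fact (N + b - X) * fact (X + (a - b) + N + b + 1)
    / (fact (X + (a - b)) * of_nat (2 * X + (a - b) + 1))"
proof -
  let ?d = "a - b"
  \<comment> \<open>The product over all Y is a Pochhammer symbol; the factor at Y = X is divided
    out afterwards.\<close>
  have "(\<Prod>Y\<le>N + b. of_nat X + of_nat Y + of_nat ?d + 1 :: complex)
      = pochhammer (of_nat (X + ?d) + 1) (N + b + 1)"
    by (simp add: pochhammer_prod lessThan_Suc_atMost[symmetric] atLeast0LessThan add_ac)
  also have "\<dots> = fact (X + ?d + N + b + 1) / fact (X + ?d)"
    by (simp only: pochhammer_of_nat_Suc add.assoc)
  finally have A: "(\<Prod>Y\<le>N + b. of_nat X + of_nat Y + of_nat ?d + 1 :: complex)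
      = fact (X + ?d + N + b + 1) / fact (X + ?d)" .
  have "(\<Prod>Y\<le>N + b. of_nat X + of_nat Y + of_nat ?d + 1 :: complex)
      = of_nat (2 * X + ?d + 1) * (\<Prod>Y\<in>{..N + b} - {X}. of_nat X + of_nat Y + of_nat ?d + 1)"
    using assms by (subst prod.remove[of _ X]) simp_all
  moreover have "(of_nat (2 * X + ?d + 1) :: complex) \<noteq> 0"
    by (subst of_nat_eq_0_iff) simp
  ultimately have "(\<Prod>Y\<in>{..N + b} - {X}. of_nat X + of_nat Y + of_nat ?d + 1 :: complex)
      = fact (X + ?d + N + b + 1) / (fact (X + ?d) * of_nat (2 * X + ?d + 1))"
    using A by (simp add: field_simps del: of_nat_add of_nat_Suc of_nat_mult fact_Suc)
  then show ?thesis
    unfolding weight_def node_diff prod.distrib prod_nat_diff[OF assms] by simp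
qed

text \<open>At this node the products contain \<open>pochhammer (- of_nat x) j\<close>, so the sum
  stops at j = x. Taking out a factor free of j leaves a Chu-Vandermonde sum of length x.\<close>

lemma q_top:
  assumes "x \<le> N"
  shows "poly (q (N + b)) (node (b + x))
    = (- 1) ^ (N + x) * fact (N + b) * fact (x + a) / (fact (b + x) * fact a)"
proof -
  let ?t = "node (b + x)"
  have N: "int (N + b) - int b = int N" by simp
  have \<pi>: "(\<Prod>i<j. ?t - of_nat i * (of_nat b + of_nat a + 1 + of_nat i))
      = (- 1) ^ j * pochhammer (- of_nat x) j * pochhammer (of_nat x + of_nat a + of_nat b + 1) j" for j
  proof -
    have "?t - of_nat i * (of_nat b + of_nat a + 1 + of_nat i)
      = (- 1) * (- of_nat x + of_nat i) * (of_nat x + of_nat a + of_nat b + 1 + of_nat i)" for i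
      by (simp add: node_add_b algebra_simps)
    then show ?thesis
      by (simp only: prod.distrib pochhammer_prod atLeast0LessThan) simp
  qed
  have c: "dual_hahn_coeff (of_nat b) (of_nat N) N j
      = (- 1) ^ N * (- 1) ^ j * pochhammer (of_nat b + 1 + of_nat j) (N - j) / fact j" if "j \<le> N" for j
  proof -
    have "pochhammer (- of_nat N + of_nat j :: complex) (N - j) = (- 1) ^ (N - j) * fact (N - j)"
      using that pochhammer_same[of "N - j", where ?'a = complex] by (simp add: of_nat_diff)
    moreover have "(- 1 :: complex) ^ (N - j) = (- 1) ^ N * (- 1) ^ j"
      using that by (simp add: minus_one_power_iff)
    ultimately show ?thesis
      using that by (simp add: dual_hahn_coeff_def add_ac)
  qed
  have "poly (q (N + b)) ?t = (\<Sum>j\<le>N. (- 1) ^ N * (pochhammer (- of_nat x) j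
      * pochhammer (of_nat x + of_nat a + of_nat b + 1) j * pochhammer (of_nat b + 1 + of_nat j) (N - j) / fact j))"
    unfolding q_def N poly_dual_hahn
  proof (intro sum.cong refl)
    fix j assume "j \<in> {..N}"
    then have j: "j \<le> N" by simp
    have "(- 1 :: complex) ^ j * (- 1) ^ j = 1" by (simp flip: power_mult_distrib)
    then show "dual_hahn_coeff (of_nat b) (of_nat N) N j
        * (\<Prod>i<j. ?t - of_nat i * (of_nat b + of_nat a + 1 + of_nat i))
      = (- 1) ^ N * (pochhammer (- of_nat x) j * pochhammer (of_nat x + of_nat a + of_nat b + 1) j
          * pochhammer (of_nat b + 1 + of_nat j) (N - j) / fact j)"
      unfolding \<pi> c[OF j] by (simp add: minus_one_power_iff)
  qed
  also have "\<dots> = (\<Sum>j\<le>x. (- 1) ^ N * (pochhammer (- of_nat x) j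
      * pochhammer (of_nat x + of_nat a + of_nat b + 1) j * pochhammer (of_nat b + 1 + of_nat j) (N - j) / fact j))"
    using assms by (intro sum.mono_neutral_right) (auto simp: pochhammer_of_nat_eq_0_iff)
  also have "\<dots> = (\<Sum>j\<le>x. (- 1) ^ N * pochhammer (of_nat (b + x) + 1) (N - x) * (pochhammer (- of_nat x) j
      * pochhammer (of_nat x + of_nat a + of_nat b + 1) j * pochhammer (of_nat b + 1 + of_nat j) (x - j) / fact j))"
  proof (intro sum.cong refl)
    fix j assume "j \<in> {..x}"
    then have "pochhammer (of_nat b + 1 + of_nat j :: complex) (N - j)
        = pochhammer (of_nat b + 1 + of_nat j) (x - j) * pochhammer (of_nat (b + x) + 1) (N - x)"
      using assms by (subst pochhammer_product[of "x - j" "N - j"]) (auto simp: of_nat_diff add_ac)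
    then show "(- 1) ^ N * (pochhammer (- of_nat x) j * pochhammer (of_nat x + of_nat a + of_nat b + 1) j
          * pochhammer (of_nat b + 1 + of_nat j) (N - j) / fact j)
      = (- 1) ^ N * pochhammer (of_nat (b + x) + 1) (N - x) * (pochhammer (- of_nat x) j
          * pochhammer (of_nat x + of_nat a + of_nat b + 1) j * pochhammer (of_nat b + 1 + of_nat j) (x - j) / (fact j :: complex))"
      by simp
  qed
  also have "\<dots> = (- 1) ^ N * pochhammer (of_nat (b + x) + 1) (N - x)
      * pochhammer (of_nat b + 1 - (of_nat x + of_nat a + of_nat b + 1)) x"
    by (simp only: pochhammer_Vandermonde flip: sum_distrib_left)
  also have "of_nat b + 1 - (of_nat x + of_nat a + of_nat b + 1) = (- of_nat (x + a) :: complex)"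
    by simp
  also have "pochhammer (- of_nat (x + a) :: complex) x = (- 1) ^ x * fact (x + a) / fact a"
    by (subst pochhammer_minus_of_nat) simp_all
  also have "pochhammer (of_nat (b + x) + 1 :: complex) (N - x) = fact (N + b) / fact (b + x)"
    using assms by (subst pochhammer_of_nat_Suc) (simp add: add_ac)
  finally show ?thesis by (simp add: power_add)
qed

lemma dual_hahn_coeff_eq_0: "j \<le> N \<Longrightarrow> N < n \<Longrightarrow> dual_hahn_coeff c (of_nat N) n j = 0"
  unfolding dual_hahn_coeff_def
  using pochhammer_of_nat_eq_0_lemma[of "N - j" "n - j", where ?'a = complex] by (simp add: of_nat_diff)

text \<open>Above degree N the coefficients with j \<le> N vanish, and products of more than N
  factors contain the one that is zero at \<open>node (b + x)\<close>.\<close>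

lemma q_above:
  assumes "N + b < k" and "x \<le> N"
  shows "poly (q k) (node (b + x)) = 0"
proof -
  define n where "n = k - b"
  have n: "int k - int b = int n" "N < n" using assms by (auto simp: n_def)
  show ?thesis
    unfolding q_def n(1) poly_dual_hahn
  proof (intro sum.neutral ballI)
    fix j
    have "(\<Prod>i<j. node (b + x) - of_nat i * (of_nat b + of_nat a + 1 + of_nat i)) = 0" if "\<not> j \<le> N"
      using that assms(2) by (intro prod_zero bexI[of _ x]) (auto simp: node_add_b)
    then show "dual_hahn_coeff (of_nat b) (of_nat N) n j
        * (\<Prod>i<j. node (b + x) - of_nat i * (of_nat b + of_nat a + 1 + of_nat i)) = 0"
      using dual_hahn_coeff_eq_0[of j n] n by auto
  qed
qed

text \<open>Only the term j = N + 1 survives: the polynomial is the monic one with roots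
  \<open>node b\<close>, ..., \<open>node (N + b)\<close>, divided by
  \<open>fact (N + 1)\<close>.\<close>

lemma q_next:
  assumes i: "i < b"
  shows "poly (q (N + b + 1)) (node i)
    = (- 1) ^ (N + 1) * fact (N + b - i) * fact (i + a + N + 1)
      / (fact (b - i - 1) * fact (i + a) * fact (N + 1))"
proof -
  have k: "int (N + b + 1) - int b = int (N + 1)" by simp
  obtain n where b: "b = i + n + 1" using less_imp_Suc_add[OF i] by auto
  have "poly (q (N + b + 1)) (node i)
      = (\<Sum>j\<in>{N + 1}. dual_hahn_coeff (of_nat b) (of_nat N) (N + 1) j
          * (\<Prod>i'<j. node i - of_nat i' * (of_nat b + of_nat a + 1 + of_nat i')))"
    unfolding q_def k poly_dual_hahn by (rule sum.mono_neutral_right) (auto simp: dual_hahn_coeff_eq_0)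
  also have "\<dots> = (\<Prod>x<N + 1. node i - node (b + x)) / fact (N + 1)"
    by (simp add: dual_hahn_coeff_def node_add_b)
  also have "(\<Prod>x<N + 1. node i - node (b + x))
      = (\<Prod>x<N + 1. (- 1) * (of_nat n + 1 + of_nat x) * (of_nat (i + a) + 1 + of_nat x))"
    using b_le_a by (intro prod.cong refl) (simp add: node_diff of_nat_diff, simp add: b algebra_simps)
  also have "\<dots> = (- 1) ^ (N + 1) * pochhammer (of_nat n + 1) (N + 1) * pochhammer (of_nat (i + a) + 1) (N + 1)"
    by (simp only: prod.distrib pochhammer_prod atLeast0LessThan) simp
  finally show ?thesis
    unfolding pochhammer_of_nat_Suc by (simp add: b add_ac del: fact_Suc)
qed

section \<open>End values of the two Hahn terms, and their agreement at index 0\<close>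

lemma F_top:
  assumes "i < b"
  shows "F i (N + b) = (- 1) ^ (N + a + b + i) * fact (N + a + b) * fact (N + b) * fact (a + i)
    / (fact (N + b - i) * fact a)"
proof -
  have "F i (N + b) = pochhammer (- of_nat (N + b + a)) (N + b + a)
      * (pochhammer (- of_nat (N + b)) i * pochhammer (of_nat a + 1) i)"
    by (simp add: F_def hahn_at_0 algebra_simps)
  also have "\<dots> = (- 1) ^ (N + b + a) * fact (N + b + a)
     * ((- 1) ^ i * fact (N + b) / fact (N + b - i) * (fact (a + i) / fact a))"
    using assms by (simp only: pochhammer_same pochhammer_of_nat_Suc) (subst pochhammer_minus_of_nat, simp_all)
  finally show ?thesis by (simp add: power_add add_ac)
qed

lemma F_above:
  assumes "N + b < k"
  shows "F i k = 0"
proof -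
  have "pochhammer (- of_nat (N + a + b) :: complex) (k + a) = 0"
    using assms by (intro pochhammer_of_nat_eq_0_lemma) simp
  then show ?thesis by (simp add: F_def algebra_simps)
qed

text \<open>At N + b + 1 \<open>F\<close> already vanishes, so this value fixes constants. The Hahn
  argument is a - 1, the point -\<alpha> - 1 for \<alpha> = -a, where a closed form is
  available.\<close>

lemma S_next:
  assumes "i < b"
  shows "S i (N + b + 1) = (- 1) ^ (N + b + 1) * fact (N + a + b) * fact (N + b - i) / (fact (a - b + i) * fact (N + 1))"
proof -
  obtain n where b: "b = i + n + 1" using less_imp_Suc_add[OF assms] by auto
  then obtain d where a: "a = i + n + 1 + d" using b_le_a by (auto simp: le_iff_add)
  have x: "of_nat N + of_nat a + of_nat b - of_nat (N + b + 1) = - (- of_nat a) - (1 :: complex)"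
    by simp
  have n: "b - i - 1 = n" by (simp add: b)
  have y: "- of_nat N - of_nat a - of_nat b = (- of_nat (N + a + b) :: complex)"
      "- of_nat a + 1 = (- of_nat (a - 1) :: complex)"
      "- (of_nat N + of_nat a + of_nat b) - - of_nat a - - of_nat b - of_nat n - 1 = (- of_nat (N + n + 1) :: complex)"
    by (simp_all add: a)
  have "S i (N + b + 1) = pochhammer (- of_nat (N + a + b)) (N + b + 1)
      * (pochhammer (- of_nat (a - 1)) n * pochhammer (- of_nat (N + n + 1)) n)"
    unfolding S_def x hahn_at_minus_Suc n y ..
  also have "pochhammer (- of_nat (N + a + b) :: complex) (N + b + 1)
      = (- 1) ^ (N + b + 1) * fact (N + a + b) / fact (a - 1)"
    by (subst pochhammer_minus_of_nat) (use b_le_a b_pos in \<open>simp_all add: a\<close>)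
  also have "pochhammer (- of_nat (a - 1) :: complex) n = (- 1) ^ n * fact (a - 1) / fact (a - b + i)"
    by (subst pochhammer_minus_of_nat) (simp_all add: a b add_ac)
  also have "pochhammer (- of_nat (N + n + 1) :: complex) n = (- 1) ^ n * fact (N + b - i) / fact (N + 1)"
    by (subst pochhammer_minus_of_nat) (simp_all add: b)
  finally show ?thesis
    by (simp add: field_simps flip: power_mult_distrib del: fact_Suc)
qed

text \<open>The ratio of the prefactors of the two Hahn terms in \<open>W_poly\<close>, leaving out
  the factor with \<open>K\<close> and the Pochhammer symbol in x that \<open>F\<close>
  contains.\<close>

definition G :: "nat \<Rightarrow> complex" where
  "G i = fact i / fact (b - i - 1) * pochhammer (- of_nat (N + a + 1 + i)) (a - b + 2 * i + 1)"

text \<open>At k = 0 each Hahn polynomial is evaluated at its own third parameter, where it factors.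
  This is the initial value that makes \<open>G i * S i k - F i k\<close> a multiple of
  \<open>q\<close> at the node.\<close>

lemma G_S_eq_F_at_0:
  assumes "i < b"
  shows "G i * S i 0 = F i 0"
proof -
  obtain n where b: "b = i + n + 1" using less_imp_Suc_add[OF assms] by auto
  then obtain d where a: "a = i + n + 1 + d" using b_le_a by (auto simp: le_iff_add)
  define N' where "N' = (of_nat (N + a + b) :: complex)"
  have n: "b - i - 1 = n" "- (- of_nat b) - of_nat n = (of_nat i + 1 :: complex)"
    by (simp_all add: b)
  have "S i 0 = hahn (b - i - 1) (- of_nat a) (- of_nat b) N' N'"
    by (simp add: S_def N'_def)
  then have "S i 0 = pochhammer (- N') n * pochhammer (of_nat i + 1) n"
    unfolding hahn_at_N n .
  moreover have "F i 0 = pochhammer (- N') a * pochhammer (- N' + of_nat a) i * pochhammer (of_nat n + 1) i"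
  proof -
    have "- of_nat N - of_nat a - of_nat b = - N'" "- (of_nat N + of_nat b) = - N' + of_nat a"
      "- (- of_nat b) - of_nat i = (of_nat n + 1 :: complex)"
      by (simp_all add: N'_def b)
    then show ?thesis
      unfolding F_def of_nat_0 diff_zero hahn_at_N add_0 by (simp only: mult.assoc)
  qed
  \<comment> \<open>\<open>pochhammer (- N') (a + i)\<close> is split once after a factors and once
    after n = b - i - 1 factors.\<close>
  moreover have "pochhammer (- N') a * pochhammer (- N' + of_nat a) i
      = pochhammer (- N') n * pochhammer (- of_nat (N + a + 1 + i)) (a - b + 2 * i + 1)"
  proof -
    have "pochhammer (- N') (a + i) = pochhammer (- N') (n + (d + 2 * i + 1))"
      by (simp add: a add_ac mult_2)
    moreover have "- N' + of_nat n = - of_nat (N + a + 1 + i)" "a - b + 2 * i + 1 = d + 2 * i + 1"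
      by (simp_all add: N'_def a b)
    ultimately show ?thesis
      by (simp only: pochhammer_product')
  qed
  ultimately show ?thesis
    unfolding G_def pochhammer_of_nat_Suc by (simp add: b add_ac)
qed

end

section \<open>The pairing with the measure\<close>

text \<open>\<open>p\<close> equals its Lagrange interpolant on n + 1 points; the sum is the
  coefficient of degree n of that interpolant, the polynomials \<open>l i\<close> being
  monic.\<close>

lemma sum_lagrange_weights:
  fixes x :: "nat \<Rightarrow> complex"
  assumes inj: "\<And>i j. x i = x j \<longleftrightarrow> i = j" and deg: "degree p \<le> n"
  shows "(\<Sum>i\<le>n. poly p (x i) / (\<Prod>j\<in>{..n} - {i}. x i - x j)) = coeff p n"
proof -
  define w where "w i = (\<Prod>j\<in>{..n} - {i}. x i - x j)" for i
  define l where "l i = (\<Prod>j\<in>{..n} - {i}. [: - x j, 1 :])" for i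
  have w0: "w i \<noteq> 0" for i
    by (simp add: w_def inj)
  have deg_l: "degree (l i) = n" if "i \<le> n" for i
    unfolding l_def using that by (subst degree_prod_eq_sum_degree) auto
  have lead_l: "coeff (l i) n = 1" if "i \<le> n" for i
    using deg_l[OF that] lead_coeff_prod[of "\<lambda>j. [: - x j, 1 :]" "{..n} - {i}"] by (simp add: l_def)
  have l_eval: "poly (l i) (x k) = (if i = k then w k else 0)" if "k \<le> n" for i k
    using that by (auto simp: l_def w_def poly_prod)
  define r where "r = (\<Sum>i\<le>n. smult (poly p (x i) / w i) (l i))"
  have "p = r"
  proof (rule poly_eqI_degree[where A = "x ` {..n}"])
    show "poly p t = poly r t" if t: "t \<in> x ` {..n}" for t
    proof -
      obtain k where k: "k \<le> n" "t = x k" using t by auto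
      have "poly r t = (\<Sum>i\<le>n. if i = k then poly p (x k) else 0)"
        unfolding r_def poly_sum by (intro sum.cong refl) (simp add: k l_eval w0)
      then show ?thesis using k by simp
    qed
    have "card (x ` {..n}) = Suc n"
      by (subst card_image) (auto simp: inj inj_on_def)
    then show "degree p < card (x ` {..n})" "degree r < card (x ` {..n})"
      using deg unfolding r_def
      by (auto simp: less_Suc_eq_le deg_l intro!: degree_sum_le order.trans[OF degree_smult_le])
  qed
  then have "coeff p n = coeff r n" by simp
  also have "\<dots> = (\<Sum>i\<le>n. poly p (x i) / w i)"
    by (simp add: r_def coeff_sum lead_l)
  finally show ?thesis by (simp add: w_def)
qed

section \<open>Integrals against finitely supported measures\<close>

lemma integral_dm_superset:
  assumes "finite A" and "Poly_Mapping.keys \<mu> \<subseteq> A"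
  shows "integral_dm \<mu> f = (\<Sum>y\<in>A. f y * Poly_Mapping.lookup \<mu> y)"
  unfolding integral_dm_def using assms by (intro sum.mono_neutral_left) (auto simp: in_keys_iff)

lemma integral_dm_single: "integral_dm (Poly_Mapping.single y m) f = f y * m"
  by (subst integral_dm_superset[of "{y}"]) auto

lemma integral_dm_add: "integral_dm (\<mu> + \<nu>) f = integral_dm \<mu> f + integral_dm \<nu> f"
proof -
  let ?A = "Poly_Mapping.keys \<mu> \<union> Poly_Mapping.keys \<nu>"
  have "integral_dm (\<mu> + \<nu>) f = (\<Sum>y\<in>?A. f y * Poly_Mapping.lookup (\<mu> + \<nu>) y)"
    using Poly_Mapping.keys_add[of \<mu> \<nu>] by (intro integral_dm_superset) auto
  also have "\<dots> = (\<Sum>y\<in>?A. f y * Poly_Mapping.lookup \<mu> y) + (\<Sum>y\<in>?A. f y * Poly_Mapping.lookup \<nu> y)"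
    by (simp add: lookup_add distrib_left sum.distrib)
  also have "\<dots> = integral_dm \<mu> f + integral_dm \<nu> f"
    by (simp add: integral_dm_superset[of ?A])
  finally show ?thesis .
qed

lemma integral_dm_sum: "integral_dm (\<Sum>x\<in>A. \<mu> x) f = (\<Sum>x\<in>A. integral_dm (\<mu> x) f)"
  by (induction A rule: infinite_finite_induct) (auto simp: integral_dm_add, simp_all add: integral_dm_def)

text \<open>A root of \<open>r\<close> at a support point removes that point from the support, so
  the sum is taken over the old support.\<close>

lemma pairing_poly_times: "pairing (poly_times_dm r \<mu>) p s = integral_dm \<mu> (\<lambda>y. poly (r * p * s) y)"
proof -
  have l: "Poly_Mapping.lookup (poly_times_dm r \<mu>) y = poly r y * Poly_Mapping.lookup \<mu> y" for y
    unfolding poly_times_dm_def by (simp add: lookup_mapp when_def in_keys_iff)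
  have "Poly_Mapping.keys (poly_times_dm r \<mu>) \<subseteq> Poly_Mapping.keys \<mu>"
    by (auto simp: in_keys_iff l)
  then show ?thesis
    unfolding pairing_def by (subst integral_dm_superset) (auto simp: l integral_dm_def mult_ac)
qed

section \<open>The masses expressed through Lagrange weights\<close>

context dual_hahn_parameters
begin

text \<open>The value of \<open>Delta\<close> at the top index N + b.\<close>

definition total :: complex where
  "total = fact (N + b) ^ 3 / fact a"

text \<open>From b on, the mass is written so that its product with \<open>q (N + b)\<close> at the
  node is \<open>total / weight X\<close>, the form needed for Lagrange interpolation.\<close>

definition mass :: "(nat \<Rightarrow> real) \<Rightarrow> nat \<Rightarrow> complex" where
  "mass M X = (if X < b
     then of_nat (2 * X + (a - b) + 1) * (fact (N + b))\<^sup>2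
       / (fact (N + b - X) * fact (N + b + X + (a - b) + 1)) * of_real (M X)
     else total / (weight X * poly (q (N + b)) (node X)))"

lemma dual_hahn_mass_eq:
  assumes "x \<le> N"
  shows "(pochhammer (of_nat N + 1) b)\<^sup>2 / pochhammer (of_nat b + 1) (a - b)
          * (dual_hahn_mass b a N x
             / (\<Prod>i<b. (of_nat x + of_nat a + of_nat i + 1) * (of_nat x + of_nat b - of_nat i)))
    = total / (weight (b + x) * poly (q (N + b)) (node (b + x)))"
proof -
  obtain y where N: "N = x + y" using assms by (auto simp: le_iff_add)
  then have "N - x = y" by simp
  have s: "(of_nat (2 * x + a + b + 1) :: complex) \<noteq> 0"
    by (subst of_nat_eq_0_iff) simp
  have p1: "pochhammer (of_nat N + 1 :: complex) b = fact (N + b) / fact N"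
    by (rule pochhammer_of_nat_Suc)
  have p2: "pochhammer (of_nat b + 1 :: complex) (a - b) = fact a / fact b"
    using b_le_a by (simp add: pochhammer_of_nat_Suc)
  have p3: "pochhammer (of_nat b + 1 :: complex) x = fact (b + x) / fact b"
    by (rule pochhammer_of_nat_Suc)
  have p4: "pochhammer (- of_nat N :: complex) x = (- 1) ^ x * fact N / fact y"
    using pochhammer_minus_of_nat[OF assms] \<open>N - x = y\<close> by (simp only:)
  have p5: "pochhammer (of_nat x + of_nat a + of_nat b + 1 :: complex) (N + 1)
      = fact (x + a + b + N + 1) / fact (x + a + b)"
    using pochhammer_of_nat_Suc[of "x + a + b" "N + 1"] by (simp add: add_ac del: fact_Suc)
  have p6: "pochhammer (of_nat a + 1 :: complex) x = fact (x + a) / fact a"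
    using pochhammer_of_nat_Suc[of a x] by (simp add: add_ac)
  have "(\<Prod>i<b. of_nat x + of_nat a + of_nat i + 1 :: complex) = pochhammer (of_nat (x + a) + 1) b"
    by (simp add: pochhammer_prod atLeast0LessThan add_ac)
  then have p7: "(\<Prod>i<b. of_nat x + of_nat a + of_nat i + 1 :: complex) = fact (x + a + b) / fact (x + a)"
    by (simp only: pochhammer_of_nat_Suc)
  have "(\<Prod>i<b. of_nat x + of_nat b - of_nat i :: complex) = (\<Prod>i<b. of_nat x + 1 + of_nat i)"
    by (rule prod.reindex_bij_witness[of _ "\<lambda>i. b - Suc i" "\<lambda>i. b - Suc i"]) (auto simp: of_nat_diff)
  then have p8: "(\<Prod>i<b. of_nat x + of_nat b - of_nat i :: complex) = fact (b + x) / fact x"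
    using pochhammer_of_nat_Suc[of x b] by (simp add: pochhammer_prod atLeast0LessThan add_ac)
  have w: "weight (b + x) = (- 1) ^ y * fact (b + x) * fact y * fact (x + a + b + N + 1)
    / (fact (x + a) * of_nat (2 * x + a + b + 1))"
  proof -
    have "b + x \<le> N + b" "N + b - (b + x) = y" "b + x + (a - b) = x + a" "b + x + (a - b) + N + b + 1 = x + a + b + N + 1"
      "2 * (b + x) + (a - b) + 1 = 2 * x + a + b + 1"
      using b_le_a assms N by auto
    then show ?thesis using weight_eq[of "b + x"] by (simp only:)
  qed
  have qt: "poly (q (N + b)) (node (b + x)) = (- 1) ^ y * fact (N + b) * fact (x + a) / (fact (b + x) * fact a)"
    unfolding q_top[OF assms] by (simp add: N power_add)
  have c: "2 * of_nat x + of_nat a + of_nat b + 1 = (of_nat (2 * x + a + b + 1) :: complex)" by simp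
  have sg: "(- 1 :: complex) ^ y * (- 1) ^ y = 1" by (simp flip: power_mult_distrib)
  have r: "total / (weight (b + x) * poly (q (N + b)) (node (b + x)))
    = fact (N + b) ^ 2 * of_nat (2 * x + a + b + 1) / (fact y * fact (x + a + b + N + 1))"
    unfolding w qt total_def using s sg
    by (simp add: divide_simps del: of_nat_add of_nat_Suc of_nat_mult fact_Suc)
       (simp add: power2_eq_square power3_eq_cube mult_ac del: of_nat_add of_nat_Suc of_nat_mult fact_Suc)
  show ?thesis
    unfolding r dual_hahn_mass_def prod.distrib c p1 p2 p3 p4 p5 p6 p7 p8 using s
    by (simp add: divide_simps del: of_nat_add of_nat_Suc of_nat_mult fact_Suc)
       (simp add: power2_eq_square mult_ac del: of_nat_add of_nat_Suc of_nat_mult fact_Suc)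
qed

lemma integral_nu_measure:
  "integral_dm (nu_measure a b N M) f = (\<Sum>X\<le>N + b. f (node X) * mass M X)"
proof -
  have "integral_dm (nu_measure a b N M) f
    = (\<Sum>x\<in>{- int b..-1}. f (lambda_ab a b (of_int x)) * ((2 * of_int x + of_nat a + of_nat b + 1)
          * pochhammer (of_nat N + 1 - of_int x) (nat (x + int b))
          / pochhammer (of_nat N + of_nat b + 1) (nat (x + int a + 1))
          * of_real (M (nat (x + int b)))))
     + (\<Sum>x\<in>{0..N}. f (lambda_ab a b (of_nat x)) * ((pochhammer (of_nat N + 1) b)\<^sup>2 / pochhammer (of_nat b + 1) (a - b)
          * (dual_hahn_mass b a N x
             / (\<Prod>i<b. (of_nat x + of_nat a + of_nat i + 1) * (of_nat x + of_nat b - of_nat i)))))"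
    by (simp only: nu_measure_def integral_dm_add integral_dm_sum integral_dm_single)
  also have "(\<Sum>x\<in>{0..N}. f (lambda_ab a b (of_nat x)) * ((pochhammer (of_nat N + 1) b)\<^sup>2 / pochhammer (of_nat b + 1) (a - b)
          * (dual_hahn_mass b a N x
             / (\<Prod>i<b. (of_nat x + of_nat a + of_nat i + 1) * (of_nat x + of_nat b - of_nat i)))))
     = (\<Sum>x\<in>{0..N}. f (node (b + x)) * mass M (b + x))"
    by (intro sum.cong refl) (simp only: dual_hahn_mass_eq atLeastAtMost_iff, simp add: mass_def node_def)
  also have "\<dots> = (\<Sum>X\<in>{b..N + b}. f (node X) * mass M X)"
    by (rule sum.reindex_bij_witness[of _ "\<lambda>X. X - b" "\<lambda>x. b + x"]) auto
  also have "(\<Sum>x\<in>{- int b..-1}. f (lambda_ab a b (of_int x)) * ((2 * of_int x + of_nat a + of_nat b + 1)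
          * pochhammer (of_nat N + 1 - of_int x) (nat (x + int b))
          / pochhammer (of_nat N + of_nat b + 1) (nat (x + int a + 1))
          * of_real (M (nat (x + int b)))))
     = (\<Sum>X\<in>{..<b}. f (node X) * mass M X)"
  proof (rule sum.reindex_bij_witness[of _ "\<lambda>X. int X - int b" "\<lambda>x. nat (x + int b)"])
    fix x assume x: "x \<in> {- int b..-1}"
    define X where "X = nat (x + int b)"
    have X: "x = int X - int b" "X < b" using x by (auto simp: X_def)
    have "nat (x + int a + 1) = X + (a - b) + 1" using X b_le_a by auto
    moreover have "of_int x = (of_nat X - of_nat b :: complex)" by (simp add: X)
    moreover have "pochhammer (of_nat N + 1 - (of_nat X - of_nat b) :: complex) X = fact (N + b) / fact (N + b - X)"
      using pochhammer_of_nat_Suc[of "N + b - X" X] X by (simp add: of_nat_diff algebra_simps)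
    moreover have "pochhammer (of_nat N + of_nat b + 1 :: complex) (X + (a - b) + 1)
        = fact (N + b + X + (a - b) + 1) / fact (N + b)"
      using pochhammer_of_nat_Suc[of "N + b" "X + (a - b) + 1"] by (simp add: add_ac del: fact_Suc)
    moreover have "2 * (of_nat X - of_nat b) + of_nat a + of_nat b + 1 = (of_nat (2 * X + (a - b) + 1) :: complex)"
      using b_le_a by (simp add: of_nat_diff)
    ultimately show "f (node (nat (x + int b))) * mass M (nat (x + int b))
      = f (lambda_ab a b (of_int x)) * ((2 * of_int x + of_nat a + of_nat b + 1)
          * pochhammer (of_nat N + 1 - of_int x) (nat (x + int b))
          / pochhammer (of_nat N + of_nat b + 1) (nat (x + int a + 1))
          * of_real (M (nat (x + int b))))"
      unfolding X_def[symmetric] mass_def node_def using X(2)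
      by (simp add: power2_eq_square del: fact_Suc of_nat_add of_nat_Suc of_nat_mult)
  qed auto
  also have "(\<Sum>X\<in>{..<b}. f (node X) * mass M X) + (\<Sum>X\<in>{b..N + b}. f (node X) * mass M X)
      = (\<Sum>X\<in>{..<b} \<union> {b..N + b}. f (node X) * mass M X)"
    by (rule sum.union_disjoint[symmetric]) auto
  also have "{..<b} \<union> {b..N + b} = {..N + b}" by auto
  finally show ?thesis .
qed

text \<open>Chosen so that \<open>- alpha i * F i (N + b)\<close> is
  \<open>total / weight i\<close>, the same shape as at the nodes from b on.\<close>

definition alpha :: "nat \<Rightarrow> complex" where
  "alpha i = - total / (F i (N + b) * weight i)"

lemma F_top_nonzero: "i < b \<Longrightarrow> F i (N + b) \<noteq> 0"
  by (simp add: F_top)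

lemma alpha_nonzero: "i < b \<Longrightarrow> alpha i \<noteq> 0"
  by (simp add: alpha_def F_top_nonzero weight_nonzero total_def)

lemma alpha_eq:
  assumes i: "i < b"
  shows "alpha i = - ((- 1) ^ a * of_nat (2 * i + (a - b) + 1) * fact (N + b) ^ 2 * fact (i + (a - b))
    / (fact (N + a + b) * fact (a + i) * fact i * fact (N + a + 1 + i)))"
proof -
  have i': "i \<le> N + b" using i by simp
  have e: "i + (a - b) + N + b + 1 = N + a + 1 + i" using b_le_a by simp
  have s: "(of_nat (2 * i + (a - b) + 1) :: complex) \<noteq> 0"
    by (subst of_nat_eq_0_iff) simp
  have sg: "(- 1 :: complex) ^ (N + a + b + i) * (- 1) ^ (N + b - i) = (- 1) ^ a"
  proof -
    obtain n where "b = i + n + 1" using less_imp_Suc_add[OF i] by auto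
    then show ?thesis by (auto simp: minus_one_power_iff)
  qed
  have "F i (N + b) * weight i = ((- 1) ^ (N + a + b + i) * (- 1) ^ (N + b - i))
      * (fact (N + a + b) * fact (N + b) * fact (a + i) * fact i * fact (N + a + 1 + i)
         / (fact a * fact (i + (a - b)) * of_nat (2 * i + (a - b) + 1)))"
    unfolding F_top[OF i] weight_eq[OF i'] e by (simp add: mult_ac)
  also note sg
  finally have A: "F i (N + b) * weight i = (- 1) ^ a
      * (fact (N + a + b) * fact (N + b) * fact (a + i) * fact i * fact (N + a + 1 + i)
         / (fact a * fact (i + (a - b)) * of_nat (2 * i + (a - b) + 1)))" .
  have sg2: "(- 1 :: complex) ^ a * (- 1) ^ a = 1" by (simp flip: power_mult_distrib)
  show ?thesis
    unfolding alpha_def total_def A using s sg2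
    by (simp add: divide_simps del: of_nat_add of_nat_Suc of_nat_mult fact_Suc)
       (simp add: power2_eq_square power3_eq_cube mult_ac del: of_nat_add of_nat_Suc of_nat_mult fact_Suc)
qed

lemma G_eq:
  assumes i: "i < b"
  shows "G i = (- 1) ^ (a - b + 1) * fact i * fact (N + a + 1 + i) / (fact (b - i - 1) * fact (N + b - i))"
proof -
  have e: "a - b + 2 * i + 1 \<le> N + a + 1 + i" "N + a + 1 + i - (a - b + 2 * i + 1) = N + b - i"
    using i b_le_a by auto
  have "(- 1 :: complex) ^ (a - b + 2 * i + 1) = (- 1) ^ (a - b + 1)"
    by (simp add: minus_one_power_iff)
  then show ?thesis
    unfolding G_def pochhammer_minus_of_nat[OF e(1)] e(2) by simp
qed

text \<open>The comparison at the index N + b + 1, which fixes the constant of proportionality in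
  \<open>mass_q\<close>.\<close>

lemma alpha_G_S_next:
  assumes i: "i < b"
  shows "alpha i * G i * S i (N + b + 1) * of_real (M i) = mass M i * poly (q (N + b + 1)) (node i)"
proof -
  have sg: "- ((- 1 :: complex) ^ a * (- 1) ^ (a - b + 1) * (- 1) ^ (N + b + 1)) = (- 1) ^ (N + 1)"
    using b_le_a by (simp add: minus_one_power_iff)
  have e: "N + b + i + (a - b) + 1 = N + a + 1 + i" "i + a + N + 1 = N + a + 1 + i" "i + a = a + i"
    "a - b + i = i + (a - b)" using b_le_a by auto
  let ?s = "of_nat (2 * i + (a - b) + 1) :: complex"
  have "alpha i * G i * S i (N + b + 1)
    = - ((- 1 :: complex) ^ a * (- 1) ^ (a - b + 1) * (- 1) ^ (N + b + 1)) *
      (?s * fact (N + b) ^ 2 / (fact (a + i) * fact (b - i - 1) * fact (N + 1)))"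
    unfolding alpha_eq[OF i] G_eq[OF i] S_next[OF i] e
    by (simp add: divide_simps del: of_nat_add of_nat_Suc of_nat_mult fact_Suc power_Suc)
  also note sg
  finally have l: "alpha i * G i * S i (N + b + 1)
    = (- 1) ^ (N + 1) * (?s * fact (N + b) ^ 2 / (fact (a + i) * fact (b - i - 1) * fact (N + 1)))" .
  show ?thesis
    unfolding l q_next[OF i] mass_def e using i
    by (simp add: divide_simps add_ac del: of_nat_add of_nat_Suc of_nat_mult fact_Suc power_Suc)
qed

lemma q_next_nonzero: "i < b \<Longrightarrow> poly (q (N + b + 1)) (node i) \<noteq> 0"
  unfolding q_next by (simp del: fact_Suc of_nat_Suc)

text \<open>The difference \<open>D\<close> solves the recurrence and vanishes at 0, so it is a
  multiple of \<open>q\<close> at the node. The multiple is read off at N + b + 1, where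
  \<open>F\<close> is 0 and \<open>q\<close> is not.\<close>

lemma mass_q:
  assumes i: "i < b"
  shows "mass M i * poly (q k) (node i) = alpha i * of_real (M i) * (G i * S i k - F i k)"
proof -
  define D where "D k = G i * S i k + (- 1) * F i k" for k
  have rec: "dual_hahn_rec (node i) D"
    unfolding D_def by (rule dual_hahn_rec_combination[OF S_rec[OF i] F_rec])
  have D: "D k = D b * poly (q k) (node i)" for k
    by (rule dual_hahn_rec_eq_q[OF rec]) (simp add: D_def G_S_eq_F_at_0[OF i])
  have "alpha i * of_real (M i) * D (N + b + 1) = mass M i * poly (q (N + b + 1)) (node i)"
    using alpha_G_S_next[OF i, of M] by (simp add: D_def F_above mult_ac)
  then have "alpha i * (of_real (M i) * D b) = mass M i"
    unfolding D[of "N + b + 1"] using q_next_nonzero[OF i] by simp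
  then show ?thesis
    using D[of k] by (simp add: D_def mult.assoc)
qed

text \<open>Pulling out \<open>1 - M i\<close> leaves
  \<open>F i k + M i / (1 - M i) * G i * S i k\<close> up to \<open>alpha i\<close>, and M / (1 - M)
  = 1 / (1 / M - 1). This is how the reciprocal parameters enter \<open>W_poly\<close>.\<close>

definition T :: "(nat \<Rightarrow> real) \<Rightarrow> nat \<Rightarrow> nat \<Rightarrow> complex" where
  "T M i k = alpha i * (F i k + of_real (M i) * (G i * S i k - F i k))"

text \<open>The defect is the part of the pairing with \<open>q k\<close> that is not accounted for by the conditions
  \<open>T M i k\<close>; it does not depend on \<open>M\<close>.\<close>

definition defect_term :: "nat \<Rightarrow> nat \<Rightarrow> complex" where
  "defect_term X k = (if X < b then - alpha X * F X k
     else total / (weight X * poly (q (N + b)) (node X)) * poly (q k) (node X))"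

definition defect :: "nat \<Rightarrow> complex poly \<Rightarrow> complex" where
  "defect k p = (\<Sum>X\<le>N + b. poly p (node X) * defect_term X k)"

text \<open>At the first b nodes the mass times \<open>q k\<close> is
  \<open>T M i k - alpha i * F i k\<close> by \<open>mass_q\<close>, and the second part goes into
  the defect; at the other nodes the whole term does.\<close>

lemma integral_q_eq_defect:
  "integral_dm (nu_measure a b N M) (poly (q k * p))
    = (\<Sum>i<b. poly p (node i) * T M i k) + defect k p"
proof -
  have split: "{..N + b} = {..<b} \<union> {b..N + b}" by auto
  have "integral_dm (nu_measure a b N M) (poly (q k * p))
      = (\<Sum>X<b. poly (q k * p) (node X) * mass M X) + (\<Sum>X\<in>{b..N + b}. poly (q k * p) (node X) * mass M X)"
    unfolding integral_nu_measure split by (rule sum.union_disjoint) auto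
  moreover have "defect k p
      = (\<Sum>X<b. poly p (node X) * defect_term X k) + (\<Sum>X\<in>{b..N + b}. poly p (node X) * defect_term X k)"
    unfolding defect_def split by (rule sum.union_disjoint) auto
  moreover have "(\<Sum>X\<in>{b..N + b}. poly (q k * p) (node X) * mass M X)
      = (\<Sum>X\<in>{b..N + b}. poly p (node X) * defect_term X k)"
    by (intro sum.cong refl) (auto simp: mass_def defect_term_def)
  moreover have "(\<Sum>X<b. poly (q k * p) (node X) * mass M X)
      = (\<Sum>i<b. poly p (node i) * T M i k) + (\<Sum>X<b. poly p (node X) * defect_term X k)"
    unfolding sum.distrib[symmetric]
  proof (intro sum.cong refl)
    fix i assume "i \<in> {..<b}"
    then have i: "i < b" by simp
    have "poly (q k * p) (node i) * mass M i = poly p (node i) * (mass M i * poly (q k) (node i))"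
      by simp
    also have "\<dots> = poly p (node i) * T M i k + poly p (node i) * defect_term i k"
      unfolding mass_q[OF i] T_def defect_term_def using i by (simp add: algebra_simps)
    finally show "poly (q k * p) (node i) * mass M i
        = poly p (node i) * T M i k + poly p (node i) * defect_term i k" .
  qed
  ultimately show ?thesis by simp
qed

lemma defect_term_rec: "dual_hahn_rec (node X) (defect_term X)"
proof (cases "X < b")
  case True
  have "dual_hahn_rec (node X) (\<lambda>k. (- alpha X) * F X k + 0 * F X k)"
    by (rule dual_hahn_rec_combination[OF F_rec F_rec])
  then show ?thesis using True by (simp add: defect_term_def[abs_def])
next
  case False
  have "dual_hahn_rec (node X) (\<lambda>k. total / (weight X * poly (q (N + b)) (node X)) * poly (q k) (node X)
      + 0 * poly (q k) (node X))"
    by (rule dual_hahn_rec_combination[OF q_rec q_rec])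
  then show ?thesis using False by (simp add: defect_term_def[abs_def])
qed

text \<open>The factor \<open>node X\<close> contributed by the variable is moved onto
  \<open>defect_term\<close> by the recurrence at that node.\<close>

lemma defect_rec:
  "defect k ([:0, 1:] * p) = (of_nat k + 1 - of_nat b) * defect (Suc k) p + rec_diag k * defect k p
     + rec_low k * defect (k - 1) p"
proof -
  have "poly ([:0, 1:] * p) (node X) * defect_term X k
      = (of_nat k + 1 - of_nat b) * (poly p (node X) * defect_term X (Suc k))
      + rec_diag k * (poly p (node X) * defect_term X k) + rec_low k * (poly p (node X) * defect_term X (k - 1))" for X
  proof -
    have *: "node X * defect_term X k = (of_nat k + 1 - of_nat b) * defect_term X (Suc k)
        + rec_diag k * defect_term X k + rec_low k * defect_term X (k - 1)"
      using defect_term_rec[of X] unfolding dual_hahn_rec_def by blast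
    have "poly ([:0, 1:] * p) (node X) * defect_term X k = poly p (node X) * (node X * defect_term X k)"
      by simp
    then show ?thesis unfolding * by (simp only: distrib_left mult.left_commute)
  qed
  then show ?thesis
    unfolding defect_def by (simp only: sum.distrib sum_distrib_left)
qed

lemma defect_above: "N + b < k \<Longrightarrow> defect k p = 0"
  unfolding defect_def
proof (intro sum.neutral ballI)
  fix X assume *: "N + b < k" "X \<in> {..N + b}"
  show "poly p (node X) * defect_term X k = 0"
  proof (cases "X < b")
    case True
    then show ?thesis using * by (simp add: defect_term_def F_above)
  next
    case False
    then have "X - b \<le> N" using * by auto
    then show ?thesis using False * q_above[of k "X - b"] by (simp add: defect_term_def)
  qed
qed

text \<open>The choices of \<open>alpha\<close> and \<open>mass\<close> make
  \<open>defect_term X (N + b)\<close> equal to \<open>total / weight X\<close> at every node, so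
  the defect is a Lagrange sum.\<close>

lemma defect_top:
  assumes "degree p \<le> N + b"
  shows "defect (N + b) p = total * coeff p (N + b)"
proof -
  have "defect_term X (N + b) = total / weight X" if X: "X \<le> N + b" for X
  proof (cases "X < b")
    case True
    then show ?thesis using F_top_nonzero[of X] by (simp add: defect_term_def alpha_def)
  next
    case False
    have "poly (q (N + b)) (node X) \<noteq> 0"
      using q_top[of "X - b"] False X by simp
    then show ?thesis using False by (simp add: defect_term_def)
  qed
  then have "defect (N + b) p = total * (\<Sum>X\<le>N + b. poly p (node X) / weight X)"
    unfolding defect_def sum_distrib_left by (intro sum.cong refl) simp
  then show ?thesis
    unfolding weight_def using sum_lagrange_weights[of node, OF node_eq_iff assms] by simp
qed

text \<open>The norm formula without the determinants, the sign and
  \<open>fact (n + card U)\<close>.\<close>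

definition Delta :: "nat \<Rightarrow> complex" where
  "Delta n = fact n * (pochhammer (- of_nat N - of_nat a - of_nat b) n)\<^sup>2
    * pochhammer (of_nat N + of_nat b + 1 - of_nat n) a / (pochhammer (of_nat N + of_nat b + 1) a)\<^sup>2"

text \<open>For k = N + b + 1 + j the Pochhammer symbol of length a meets 0 if j < a, and otherwise
  the one of length k does.\<close>

lemma Delta_eq_0: "N + b < k \<Longrightarrow> Delta k = 0"
proof -
  assume k: "N + b < k"
  then obtain j where j: "k = N + b + 1 + j" using less_imp_Suc_add by fastforce
  show ?thesis
  proof (cases "j < a")
    case True
    have "pochhammer (- of_nat j :: complex) a = 0"
      using True by (rule pochhammer_of_nat_eq_0_lemma)
    moreover have "of_nat N + of_nat b + 1 - of_nat k = (- of_nat j :: complex)" by (simp add: j)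
    ultimately show ?thesis by (simp add: Delta_def)
  next
    case False
    have z: "pochhammer (- of_nat (N + a + b) :: complex) k = 0"
      using False j by (intro pochhammer_of_nat_eq_0_lemma) simp
    have e: "- of_nat N - of_nat a - of_nat b = (- of_nat (N + a + b) :: complex)" by simp
    show ?thesis unfolding Delta_def e z by simp
  qed
qed

lemma Delta_top: "Delta (N + b) = total"
proof -
  have e: "- of_nat N - of_nat a - of_nat b = (- of_nat (N + a + b) :: complex)"
    "of_nat N + of_nat b + 1 = (of_nat (N + b) + 1 :: complex)"
    "of_nat (N + b) + 1 - of_nat (N + b) = (1 :: complex)" by simp_all
  have p: "pochhammer (- of_nat (N + a + b) :: complex) (N + b) = (- 1) ^ (N + b) * fact (N + a + b) / fact a"
    by (subst pochhammer_minus_of_nat) simp_all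
  have p1: "pochhammer (1 :: complex) a = fact a" by (simp add: pochhammer_fact)
  have p2: "pochhammer (of_nat (N + b) + 1 :: complex) a = fact (N + a + b) / fact (N + b)"
    unfolding pochhammer_of_nat_Suc by (simp add: add_ac)
  have sg: "((- 1 :: complex) ^ (N + b))\<^sup>2 = 1" by (simp flip: power_mult)
  show ?thesis
    unfolding Delta_def e p p1 p2 total_def power_divide power_mult_distrib sg
    by (simp add: field_simps power2_eq_square power3_eq_cube)
qed

lemma Delta_nonzero:
  assumes "k \<le> N + b"
  shows "Delta k \<noteq> 0"
proof -
  have e: "- of_nat N - of_nat a - of_nat b = (- of_nat (N + a + b) :: complex)"
    "of_nat N + of_nat b + 1 = (of_nat (N + b) + 1 :: complex)"
    "of_nat (N + b) + 1 - of_nat k = (of_nat (N + b - k) + 1 :: complex)"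
    using assms by (simp_all add: of_nat_diff)
  have k: "k \<le> N + a + b" using assms by simp
  show ?thesis
    unfolding Delta_def e pochhammer_of_nat_Suc pochhammer_minus_of_nat[OF k] by simp
qed

text \<open>Matches the step of the downward induction, where only the \<open>rec_low\<close> term
  of the recurrence is left.\<close>

lemma Delta_step:
  assumes "k < N + b"
  shows "Delta (Suc k) = rec_low (Suc k) * Delta k"
proof -
  define j where "j = N + b - Suc k"
  have j: "N + b = k + 1 + j" using assms by (simp add: j_def)
  have e: "of_nat N + of_nat b + 1 - of_nat (Suc k) = (of_nat j + 1 :: complex)"
    "of_nat N + of_nat b + 1 - of_nat k = (of_nat j + 1 + 1 :: complex)"
    using arg_cong[OF j, of "of_nat :: nat \<Rightarrow> complex"] by (simp_all add: algebra_simps)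
  have p: "(of_nat j + 1) * pochhammer (of_nat j + 1 + 1 :: complex) a
      = pochhammer (of_nat j + 1) a * (of_nat j + 1 + of_nat a)"
    by (simp only: pochhammer_Suc flip: pochhammer_rec)
  have h: "of_nat (Suc k) - of_nat b - 1 - of_nat N = - (of_nat j + 1 :: complex)"
    "of_nat (Suc k) - of_nat b - of_nat a - of_nat N - 1 = - (of_nat j + 1 + of_nat a :: complex)"
    using e(2) by (simp_all add: algebra_simps)
  have r: "rec_low (Suc k) = of_nat (Suc k) * (of_nat j + 1) * (of_nat j + 1 + of_nat a)"
    unfolding rec_low_def h by (simp only: mult_minus_left mult_minus_right minus_minus)
  have m: "(- of_nat N - of_nat a - of_nat b + of_nat k)= - (of_nat j + 1 + of_nat a :: complex)"
    using e(2) by (simp add: algebra_simps)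
  let ?P = "pochhammer (- of_nat N - of_nat a - of_nat b :: complex) k"
  let ?D = "(pochhammer (of_nat N + of_nat b + 1 :: complex) a)\<^sup>2"
  have "Delta (Suc k) = of_nat (Suc k) * fact k * (?P * - (of_nat j + 1 + of_nat a))\<^sup>2 * pochhammer (of_nat j + 1) a / ?D"
    unfolding Delta_def e(1) pochhammer_Suc fact_Suc m by simp
  also have "\<dots> = of_nat (Suc k) * (of_nat j + 1 + of_nat a) * (fact k * ?P\<^sup>2
      * (pochhammer (of_nat j + 1) a * (of_nat j + 1 + of_nat a)) / ?D)"
    by (simp only: mult_minus_right mult_minus_left minus_minus power2_eq_square mult_ac times_divide_eq_left times_divide_eq_right)
  also have "\<dots> = rec_low (Suc k) * Delta k"
    unfolding p[symmetric] r Delta_def e(2) by (simp only: mult_ac times_divide_eq_left times_divide_eq_right)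
  finally show ?thesis .
qed

lemma rec_low_nonzero:
  assumes "k < N + b"
  shows "rec_low (Suc k) \<noteq> 0"
  using Delta_step[OF assms] Delta_nonzero[of "Suc k"] assms by auto

text \<open>Downward induction on \<open>k\<close>: the recurrence lowers both the index of \<open>q\<close> and the degree of
  the test polynomial, starting from Lagrange interpolation on the full support at \<open>k = N + b\<close>.\<close>

theorem defect_eq:
  assumes "degree p \<le> k"
  shows "defect k p = coeff p k * Delta k"
  using assms
proof (induction "N + b + 1 - k" arbitrary: k p rule: less_induct)
  case less
  consider "N + b < k" | "k = N + b" | "k < N + b" by linarith
  then show ?case
  proof cases
    case 1
    then show ?thesis by (simp add: defect_above Delta_eq_0)
  next
    case 2
    then show ?thesis using defect_top less.prems by (simp add: Delta_top)
  next
    case 3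
    have "degree ([:0, 1:] * p) \<le> Suc k"
      using less.prems by (simp add: degree_mult_le order.trans[OF degree_mult_le])
    then have "defect (Suc k) ([:0, 1:] * p) = coeff ([:0, 1:] * p) (Suc k) * Delta (Suc k)"
      using less.hyps[of "Suc k" "[:0, 1:] * p"] 3 by simp
    \<comment> \<open>\<open>degree p \<le> k\<close> makes the coefficients at k + 1 and k + 2
      zero, so on the right of \<open>defect_rec\<close> at \<open>Suc k\<close> only the term with
      \<open>rec_low\<close> survives.\<close>
    moreover have "defect (Suc k) p = 0" "defect (Suc (Suc k)) p = 0"
      using less.hyps[of "Suc k" p] less.hyps[of "Suc (Suc k)" p] less.prems 3 by (simp_all add: coeff_eq_0)
    ultimately have "coeff p k * Delta (Suc k) = rec_low (Suc k) * defect k p"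
      using defect_rec[of "Suc k" p] by simp
    then show ?thesis
      unfolding Delta_step[OF 3] using rec_low_nonzero[OF 3] by simp
  qed
qed

lemma W_entry_shift: "W_entry a b N M n f j = W_entry a b N M (n + j) f 0"
  by (simp add: W_entry_def diff_diff_eq)

lemma W_entry_eq_T:
  assumes i: "i < b" and M: "M i \<noteq> 0" "M i \<noteq> 1"
  shows "\<exists>c. \<forall>k. T M i k = c * W_entry a b N M k (a + i) 0"
proof -
  define s :: complex where "s = (- 1) ^ (b + (a + i)) * fact (a + i - b) * fact (b - i - 1)"
  have s: "s \<noteq> 0" by (simp add: s_def)
  have "W_entry a b N M k (a + i) 0 = s / (1 - of_real (M i)) / alpha i * T M i k" for k
  proof -
    let ?p = "pochhammer (- of_nat N - of_nat a - of_nat b :: complex)"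
    let ?x = "of_nat N + of_nat a + of_nat b - of_nat k :: complex"
    have e: "a + i - a = i" "b + a - (a + i) - 1 = b - i - 1" "a + b - (a + i) - 1 = b - i - 1"
      "2 * (a + i) + 1 - a - b = a - b + 2 * i + 1" using b_le_a by auto
    have f: "- 2 - of_int (- 2 - int N - int a - int b) - of_nat a = (of_nat N + of_nat b :: complex)"
      "- 2 - of_int (- 2 - int N - int a - int b) = (of_nat N + of_nat a + of_nat b :: complex)"
      "?x - of_nat 0 = ?x" "?x - of_nat a = of_nat N + of_nat b - of_nat k" by simp_all
    have g: "of_int (- 2 - int N - int a - int b) + of_nat a + of_nat b + 1 - of_nat (a + i)
      = (- of_nat (N + a + 1 + i) :: complex)" by simp
    \<comment> \<open>Since \<open>- ?x\<close> is k - N - a - b, this symbol continues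
      \<open>?p k\<close> by the next a factors.\<close>
    have "?p k * pochhammer (- ?x) a = ?p (k + a)"
      by (simp add: pochhammer_product') (simp add: algebra_simps)
    then have Fk: "F i k = ?p k * pochhammer (- ?x) a
        * hahn i (of_nat a) (- of_nat b) (of_nat N + of_nat b) (of_nat N + of_nat b - of_nat k)"
      by (simp add: F_def)
    have W: "W_entry a b N M k (a + i) 0 = ?p k * ((- 1) ^ (b + (a + i)) * fact (a + i - b) *
      (fact (b - i - 1) * pochhammer (- ?x) a
         * hahn i (of_nat a) (- of_nat b) (of_nat N + of_nat b) (of_nat N + of_nat b - of_nat k)
       + fact i * pochhammer (- of_nat (N + a + 1 + i)) (a - b + 2 * i + 1)
         / (of_real (1 / M i) - 1)
         * hahn (b - i - 1) (- of_nat a) (- of_nat b) (of_nat N + of_nat a + of_nat b) ?x))"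
      unfolding W_entry_def W_poly_def e f g by simp
    define Z :: complex where "Z = of_real (1 / M i) - 1"
    have m: "of_real (M i) \<noteq> (0::complex)" "1 - of_real (M i) \<noteq> (0::complex)"
      using M by auto
    then have Z: "1 / Z = of_real (M i) / (1 - of_real (M i))"
      by (simp add: Z_def field_simps)
    have "W_entry a b N M k (a + i) 0 = s * (F i k + G i * (1 / Z) * S i k)"
      unfolding W Fk S_def G_def s_def Z_def[symmetric] by (simp add: distrib_left mult_ac)
    then have W': "W_entry a b N M k (a + i) 0
        = s * (F i k + G i * (of_real (M i) / (1 - of_real (M i))) * S i k)"
      unfolding Z .
    show ?thesis
      unfolding W' T_def using m alpha_nonzero[OF i] by (simp add: field_simps)
  qed
  then have "T M i k = (1 - of_real (M i)) * alpha i / s * W_entry a b N M k (a + i) 0" for k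
    using s alpha_nonzero[OF i] M by (simp add: field_simps)
  then show ?thesis by blast
qed

end

section \<open>Determinantal orthogonal polynomials\<close>

text \<open>The cofactors do not involve the first row \<open>v\<close>, so the same ones serve as
  coefficients of \<open>Q\<close> and in the vanishing sums for a repeated row.\<close>

lemma det_replace_first_row:
  fixes v :: "nat \<Rightarrow> 'a :: comm_ring_1"
  shows "Determinant.det (Matrix.mat (Suc m) (Suc m) (\<lambda>(i, j). if i = 0 then v j else g (i - 1) j))
    = (\<Sum>j<Suc m. v j * ((- 1) ^ j
        * Determinant.det (Matrix.mat m m (\<lambda>(i, j'). g i (if j' < j then j' else Suc j')))))"
proof -
  let ?A = "Matrix.mat (Suc m) (Suc m) (\<lambda>(i, j). if i = 0 then v j else g (i - 1) j)"
  have "Determinant.det ?A = (\<Sum>j<Suc m. ?A $$ (0, j) * cofactor ?A 0 j)"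
    by (rule laplace_expansion_row) auto
  also have "\<dots> = (\<Sum>j<Suc m. v j * ((- 1) ^ j
        * Determinant.det (Matrix.mat m m (\<lambda>(i, j'). g i (if j' < j then j' else Suc j')))))"
  proof (intro sum.cong refl)
    fix j assume j: "j \<in> {..<Suc m}"
    have "mat_delete ?A 0 j = Matrix.mat m m (\<lambda>(i, j'). g i (if j' < j then j' else Suc j'))"
      using j by (intro eq_matI) (auto simp: mat_delete_def)
    then show "?A $$ (0, j) * cofactor ?A 0 j = v j * ((- 1) ^ j
        * Determinant.det (Matrix.mat m m (\<lambda>(i, j'). g i (if j' < j then j' else Suc j'))))"
      using j by (simp add: cofactor_def)
  qed
  finally show ?thesis .
qed

lemma det_const_poly:
  "Determinant.det (Matrix.mat m m (\<lambda>(i, j). [:g i j :: complex:])) = [:Determinant.det (Matrix.mat m m (\<lambda>(i, j). g i j)):]"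
proof -
  interpret comm_ring_hom "\<lambda>c :: complex. [:c:]"
    by unfold_locales (simp_all add: one_pCons)
  have "Matrix.mat m m (\<lambda>(i, j). [:g i j:]) = map_mat (\<lambda>c. [:c:]) (Matrix.mat m m (\<lambda>(i, j). g i j))"
    by (intro eq_matI) auto
  then show ?thesis by (simp only: hom_det)
qed

text \<open>Christoffel's construction: a combination of the \<open>q k\<close> that is annihilated by the \<open>b\<close>
  conditions \<open>w\<close> is orthogonal to low degrees, and one that vanishes on \<open>us\<close> can be divided by the
  polynomial \<open>V\<close> which multiplies the functional. The nodes are not needed: the coefficients \<open>t i p\<close> may
  depend on the test polynomial in any way.\<close>

locale determinantal_polynomials =
  fixes b :: nat and q :: "nat \<Rightarrow> complex poly" and w :: "nat \<Rightarrow> nat \<Rightarrow> complex"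
    and L :: "complex poly \<Rightarrow> complex" and t :: "nat \<Rightarrow> complex poly \<Rightarrow> complex"
    and \<Delta> :: "nat \<Rightarrow> complex" and us :: "complex list"
  assumes L_add: "L (p + r) = L p + L r" and L_smult: "L (smult c p) = c * L p"
    and q_low: "k < b \<Longrightarrow> q k = 0"
    and degree_q: "b \<le> k \<Longrightarrow> degree (q k) \<le> k - b"
    and coeff_q: "b \<le> k \<Longrightarrow> coeff (q k) (k - b) = 1 / fact (k - b)"
    and L_q: "degree p \<le> k \<Longrightarrow> L (q k * p) = (\<Sum>i<b. t i p * w i k) + coeff p k * \<Delta> k"
    and distinct_us: "distinct us"
    and \<Delta>_low: "k < b \<Longrightarrow> \<Delta> k \<noteq> 0"
begin

definition V :: "complex poly" where
  "V = (\<Prod>u\<in>set us. [: - u, 1 :])"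

definition entry :: "nat \<Rightarrow> nat \<Rightarrow> complex" where
  "entry i k = (if i < b then w i k else poly (q k) (us ! (i - b)))"

definition psi :: "nat \<Rightarrow> complex" where
  "psi n = Determinant.det (Matrix.mat (b + length us) (b + length us) (\<lambda>(i, j). entry i (n + j)))"

definition Q :: "nat \<Rightarrow> complex poly" where
  "Q n = Determinant.det (Matrix.mat (Suc (b + length us)) (Suc (b + length us))
     (\<lambda>(i, j). if i = 0 then q (n + j) else [:entry (i - 1) (n + j):]))"

definition cof :: "nat \<Rightarrow> nat \<Rightarrow> complex" where
  "cof n j = (- 1) ^ j * Determinant.det (Matrix.mat (b + length us) (b + length us)
     (\<lambda>(i, j'). entry i (n + (if j' < j then j' else Suc j'))))"

definition pair :: "complex poly \<Rightarrow> complex poly \<Rightarrow> complex" where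
  "pair p r = L (V * p * r)"

section \<open>Combinations annihilated by all rows of the matrix\<close>

lemma L_0: "L 0 = 0"
  using L_smult[of 0 0] by simp

lemma L_sum: "L (\<Sum>x\<in>A. f x) = (\<Sum>x\<in>A. L (f x))"
  by (induction A rule: infinite_finite_induct) (simp_all add: L_0 L_add)

lemma V_nonzero: "V \<noteq> 0"
  by (simp add: V_def)

lemma degree_V: "degree V = length us"
  unfolding V_def using distinct_us by (subst degree_prod_eq_sum_degree) (auto simp: distinct_card)

lemma lead_coeff_V: "coeff V (length us) = 1"
  unfolding degree_V[symmetric] V_def by (subst lead_coeff_prod) simp

lemma V_dvd:
  assumes "\<And>u. u \<in> set us \<Longrightarrow> poly p u = 0"
  shows "V dvd p"
proof -
  have "(\<Prod>u\<in>A. [: - u, 1 :]) dvd p" if "finite A" "A \<subseteq> set us" for A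
    using that
  proof (induction A rule: finite_induct)
    case (insert u A)
    then obtain r where r: "p = (\<Prod>u\<in>A. [: - u, 1 :]) * r" by (auto elim: dvdE)
    have "poly (\<Prod>u\<in>A. [: - u, 1 :]) u \<noteq> 0"
      using insert.hyps by (auto simp: poly_prod)
    moreover have "poly p u = 0" using insert.prems assms by auto
    ultimately have "[: - u, 1 :] dvd r" by (simp add: r poly_eq_0_iff_dvd[symmetric])
    then show ?case
      using insert.hyps by (simp add: r mult.commute[of _ r] mult_dvd_mono del: mult_pCons_left mult_pCons_right)
  qed simp
  then show ?thesis by (simp add: V_def)
qed

lemma Q_eq: "Q n = (\<Sum>j<Suc (b + length us). smult (cof n j) (q (n + j)))"
  unfolding Q_def det_const_poly cof_def
    det_replace_first_row[where v = "\<lambda>j. q (n + j)" and g = "\<lambda>i j. [:entry i (n + j):]"]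
  by (intro sum.cong refl) (simp add: mult.commute minus_one_power_iff)

lemma cof_0: "cof n 0 = psi (Suc n)"
  by (simp add: cof_def psi_def)

lemma cof_top: "cof n (b + length us) = (- 1) ^ (b + length us) * psi n"
proof -
  have "Matrix.mat (b + length us) (b + length us)
     (\<lambda>(i, j'). entry i (n + (if j' < b + length us then j' else Suc j')))
   = Matrix.mat (b + length us) (b + length us) (\<lambda>(i, j). entry i (n + j))"
    by (intro eq_matI) auto
  then show ?thesis by (simp add: cof_def psi_def)
qed

text \<open>The sum expands a determinant whose first row repeats a later one.\<close>

lemma cof_orthogonal:
  assumes i: "i < b + length us"
  shows "(\<Sum>j<Suc (b + length us). cof n j * entry i (n + j)) = 0"
proof -
  let ?m = "b + length us"
  let ?A = "Matrix.mat (Suc ?m) (Suc ?m) (\<lambda>(r, j). if r = 0 then entry i (n + j) else entry (r - 1) (n + j))"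
  have "Determinant.det ?A = 0"
    by (rule det_identical_rows[of _ "Suc ?m" 0 "Suc i"]) (use i in \<open>auto simp: row_def\<close>)
  then show ?thesis
    unfolding cof_def
      det_replace_first_row[where v = "\<lambda>j. entry i (n + j)" and g = "\<lambda>i j. entry i (n + j)"]
    by (simp only: mult.commute)
qed

lemma V_dvd_combination:
  assumes "\<And>i. i < b + length us \<Longrightarrow> (\<Sum>j<m. c j * entry i (n + j)) = 0"
  shows "V dvd (\<Sum>j<m. smult (c j) (q (n + j)))"
proof (rule V_dvd)
  fix u assume "u \<in> set us"
  then obtain l where l: "l < length us" "u = us ! l" by (auto simp: in_set_conv_nth)
  then show "poly (\<Sum>j<m. smult (c j) (q (n + j))) u = 0"
    using assms[of "b + l"] by (simp add: poly_sum entry_def)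
qed

text \<open>The first b conditions remove the sums with \<open>t\<close>, and
  \<open>degree p \<le> n\<close> leaves only j = 0 among the terms with \<Delta>.\<close>

lemma L_combination:
  assumes c: "\<And>i. i < b + length us \<Longrightarrow> (\<Sum>j<m. c j * entry i (n + j)) = 0"
    and p: "degree p \<le> n" and m: "0 < m"
  shows "L ((\<Sum>j<m. smult (c j) (q (n + j))) * p) = c 0 * coeff p n * \<Delta> n"
proof -
  have w: "(\<Sum>j<m. c j * w i (n + j)) = 0" if "i < b" for i
    using c[of i] that by (simp add: entry_def)
  have "L ((\<Sum>j<m. smult (c j) (q (n + j))) * p) = (\<Sum>j<m. c j * L (q (n + j) * p))"
    by (simp add: sum_distrib_right L_sum L_smult)
  also have "\<dots> = (\<Sum>j<m. c j * (\<Sum>i<b. t i p * w i (n + j))) + (\<Sum>j<m. c j * (coeff p (n + j) * \<Delta> (n + j)))"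
    using p by (simp add: L_q distrib_left sum.distrib)
  also have "(\<Sum>j<m. c j * (\<Sum>i<b. t i p * w i (n + j))) = (\<Sum>i<b. t i p * (\<Sum>j<m. c j * w i (n + j)))"
    unfolding sum_distrib_left by (subst sum.swap) (simp add: mult_ac)
  also have "\<dots> = 0" using w by simp
  also have "(\<Sum>j<m. c j * (coeff p (n + j) * \<Delta> (n + j))) = (\<Sum>j\<in>{0}. c j * (coeff p (n + j) * \<Delta> (n + j)))"
    using m p by (intro sum.mono_neutral_right) (auto simp: coeff_eq_0)
  finally show ?thesis by simp
qed

section \<open>The quotients, their leading coefficients and norms\<close>

definition r :: "nat \<Rightarrow> complex poly" where
  "r n = Q n div V"

lemma V_times_r: "V * r n = Q n"
proof -
  have "V dvd Q n"
    unfolding Q_eq by (rule V_dvd_combination) (rule cof_orthogonal)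
  then show ?thesis by (simp add: r_def)
qed

lemma pair_r:
  assumes "degree p \<le> n"
  shows "pair (r n) p = psi (Suc n) * coeff p n * \<Delta> n"
proof -
  have "pair (r n) p = L (Q n * p)"
    by (simp add: pair_def V_times_r)
  also have "\<dots> = cof n 0 * coeff p n * \<Delta> n"
    unfolding Q_eq by (rule L_combination[OF cof_orthogonal assms]) auto
  finally show ?thesis by (simp add: cof_0)
qed

lemma degree_q_combination: "degree (\<Sum>j<m. smult (c j) (q (n + j))) \<le> n + m - 1 - b"
proof (intro degree_sum_le)
  fix j assume "j \<in> {..<m}"
  then show "degree (smult (c j) (q (n + j))) \<le> n + m - 1 - b"
    using degree_q[of "n + j"] by (cases "n + j < b") (auto simp: q_low)
qed simp

text \<open>Only the last column reaches this degree, and its cofactor is \<open>psi n\<close> up to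
  sign.\<close>

lemma coeff_Q: "coeff (Q n) (n + length us) = (- 1) ^ (b + length us) * psi n / fact (n + length us)"
proof -
  have z: "coeff (q (n + j)) (n + length us) = 0" if "j < b + length us" for j
    using degree_q[of "n + j"] that by (cases "n + j < b") (auto simp: q_low intro!: coeff_eq_0)
  have "coeff (Q n) (n + length us) = (\<Sum>j\<in>{b + length us}. cof n j * coeff (q (n + j)) (n + length us))"
    unfolding Q_eq by (simp add: coeff_sum z)
  also have "\<dots> = cof n (b + length us) * (1 / fact (n + length us))"
    using coeff_q[of "n + (b + length us)"] by simp
  finally show ?thesis by (simp add: cof_top)
qed

lemma degree_Q: "degree (Q n) \<le> n + length us"
  unfolding Q_eq using degree_q_combination[of "cof n" n "Suc (b + length us)"] by simp

lemma degree_r_le: "degree (r n) \<le> n"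
proof (cases "r n = 0")
  case False
  then have "degree (V * r n) = length us + degree (r n)"
    by (simp add: degree_mult_eq V_nonzero degree_V)
  then show ?thesis
    using degree_Q[of n] by (simp add: V_times_r)
qed simp

lemma coeff_r: "coeff (r n) n = (- 1) ^ (b + length us) * psi n / fact (n + length us)"
proof -
  have "coeff (V * r n) (length us + n) = coeff V (length us) * coeff (r n) n"
  proof (cases "degree (r n) = n")
    case True
    then show ?thesis using coeff_mult_degree_sum[of V "r n"] by (simp add: degree_V)
  next
    case False
    then have "degree (r n) < n" using degree_r_le[of n] by simp
    then show ?thesis
      using degree_mult_le[of V "r n"] by (simp add: coeff_eq_0 degree_V)
  qed
  then show ?thesis
    by (simp add: V_times_r coeff_Q lead_coeff_V add.commute)
qed

lemma degree_r: "psi n \<noteq> 0 \<Longrightarrow> degree (r n) = n"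
  using degree_r_le[of n] le_degree[of "r n" n] coeff_r[of n] by simp

lemma pair_r_self: "pair (r n) (r n)
    = (- 1) ^ (b + length us) * psi n * psi (Suc n) * \<Delta> n / fact (n + length us)"
  by (simp add: pair_r degree_r_le coeff_r)

lemma pair_commute: "pair p s = pair s p"
  by (simp add: pair_def mult_ac)

lemma pair_r_r:
  assumes "n \<noteq> k"
  shows "pair (r n) (r k) = 0"
proof -
  have "pair (r n) (r k) = 0" if "k < n" for n k
    using that degree_r_le[of k] by (subst pair_r) (auto simp: coeff_eq_0)
  then show ?thesis
    using assms pair_commute by (metis nat_neq_iff)
qed

lemma pair_sum: "pair (\<Sum>x\<in>A. smult (c x) (f x)) s = (\<Sum>x\<in>A. c x * pair (f x) s)"
  by (simp add: pair_def sum_distrib_left sum_distrib_right L_sum L_smult)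

section \<open>Nonvanishing of the determinants when an orthogonal sequence exists\<close>

lemma degree_basis_expansion:
  assumes deg: "\<And>k. k \<le> d \<Longrightarrow> degree (p k) = k \<and> p k \<noteq> 0" and s: "degree s \<le> d"
  shows "\<exists>c. s = (\<Sum>l\<le>d. smult (c l) (p l :: complex poly))"
  using assms
proof (induction d arbitrary: s)
  case 0
  obtain x y where x: "s = [:x:]" and y: "p 0 = [:y:]" "y \<noteq> 0"
    using 0 degree_eq_zeroE by (metis bot_nat_0.extremum_uniqueI order.refl pCons_0_0)
  have "s = smult (x / y) (p 0)" by (simp add: x y)
  then show ?case by (intro exI[of _ "\<lambda>_. x / y"]) simp
next
  case (Suc d)
  define e where "e = coeff s (Suc d) / coeff (p (Suc d)) (Suc d)"
  define s' where "s' = s - smult e (p (Suc d))"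
  have p: "degree (p (Suc d)) = Suc d" "p (Suc d) \<noteq> 0"
    using Suc.prems(1)[of "Suc d"] by auto
  then have nz: "coeff (p (Suc d)) (Suc d) \<noteq> 0"
    by (metis leading_coeff_0_iff)
  have "degree s' \<le> Suc d"
    unfolding s'_def using Suc.prems(2) p by (intro degree_diff_le order.trans[OF degree_smult_le]) auto
  moreover have "coeff s' (Suc d) = 0"
    using nz by (simp add: s'_def e_def)
  ultimately have "degree s' \<le> d"
    by (metis le_SucE leading_coeff_0_iff degree_0 le0)
  then obtain c where c: "s' = (\<Sum>l\<le>d. smult (c l) (p l))"
    using Suc.IH[of s'] Suc.prems(1) by auto
  have "s = (\<Sum>l\<le>Suc d. smult ((c(Suc d := e)) l) (p l))"
  proof -
    have "s = s' + smult e (p (Suc d))" by (simp add: s'_def)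
    also have "s' = (\<Sum>l\<le>d. smult ((c(Suc d := e)) l) (p l))"
      unfolding c by (intro sum.cong refl) auto
    finally show ?thesis by simp
  qed
  then show ?case by blast
qed

text \<open>A zero of \<open>psi n\<close> gives a kernel vector and a combination
  \<open>Q' = V * s\<close>. Orthogonality forces \<open>s = 0\<close>; the dependence then involves
  only the zero polynomials \<open>q k\<close> with k < b, and testing against a monomial
  contradicts \<open>\<Delta>_low\<close>.\<close>

lemma psi_nonzero:
  assumes deg: "\<And>k. k \<le> K \<Longrightarrow> degree (p k) = k"
    and ortho: "\<And>k l. k \<le> K \<Longrightarrow> l \<le> K \<Longrightarrow> k \<noteq> l \<Longrightarrow> pair (p k) (p l) = 0"
    and norm: "\<And>k. k \<le> K \<Longrightarrow> pair (p k) (p k) \<noteq> 0"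
    and n: "n \<le> Suc K"
  shows "psi n \<noteq> 0"
proof
  assume "psi n = 0"
  let ?m = "b + length us"
  let ?A = "Matrix.mat ?m ?m (\<lambda>(i, j). entry i (n + j))"
  have "\<exists>v. v \<in> carrier_vec ?m \<and> v \<noteq> 0\<^sub>v ?m \<and> ?A *\<^sub>v v = 0\<^sub>v ?m"
    using \<open>psi n = 0\<close> unfolding psi_def by (subst (asm) det_0_iff_vec_prod_zero) auto
  then obtain v where v: "v \<in> carrier_vec ?m" "v \<noteq> 0\<^sub>v ?m" "?A *\<^sub>v v = 0\<^sub>v ?m"
    by blast
  define c where "c j = vec_index v j" for j
  have c: "(\<Sum>j<?m. c j * entry i (n + j)) = 0" if "i < ?m" for i
  proof -
    have "vec_index (?A *\<^sub>v v) i = (\<Sum>j<?m. entry i (n + j) * c j)"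
      using that v(1) by (simp add: scalar_prod_def c_def atLeast0LessThan)
    then show ?thesis using v(3) that by (simp add: mult.commute)
  qed
  define J where "J = {j. j < ?m \<and> c j \<noteq> 0}"
  have "J \<noteq> {}"
  proof
    assume "J = {}"
    then have "v = 0\<^sub>v ?m"
      using v(1) by (intro eq_vecI) (auto simp: J_def c_def)
    then show False using v(2) by simp
  qed
  then have m: "0 < ?m" by (auto simp: J_def)
  have "finite J" by (simp add: J_def)
  define Q' where "Q' = (\<Sum>j<?m. smult (c j) (q (n + j)))"
  have "V dvd Q'"
    unfolding Q'_def using c by (rule V_dvd_combination)
  then obtain s where s: "Q' = V * s" by (auto elim: dvdE)
  have "s = 0"
  proof (rule ccontr)
    assume "s \<noteq> 0"
    then have dQ: "degree Q' = length us + degree s"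
      by (simp add: s degree_mult_eq V_nonzero degree_V)
    \<comment> \<open>The degree bound \<open>n + ?m - 1 - b\<close> is truncated at 0 when
      \<open>n + length us = 0\<close>; in that case all the \<open>q\<close> involved are
      0.\<close>
    have "n + length us \<noteq> 0"
    proof
      assume "n + length us = 0"
      then have "Q' = 0" by (simp add: Q'_def q_low)
      then show False using \<open>s \<noteq> 0\<close> by (simp add: s V_nonzero)
    qed
    then have ds: "degree s < n"
      using degree_q_combination[of c n ?m] dQ unfolding Q'_def by linarith
    have "\<exists>e. s = (\<Sum>l\<le>n - 1. smult (e l) (p l))"
    proof (rule degree_basis_expansion)
      fix k assume "k \<le> n - 1"
      then have "k \<le> K" using ds n by simp
      then show "degree (p k) = k \<and> p k \<noteq> 0"
        using deg norm[of k] by (auto simp: pair_def L_0)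
    qed (use ds in simp)
    then obtain e where e: "s = (\<Sum>l\<le>n - 1. smult (e l) (p l))" by blast
    \<comment> \<open>The pairing of \<open>s\<close> with \<open>p k\<close> is \<open>e k\<close>
      times a nonzero norm, but also 0, because \<open>p k\<close> has degree below n.\<close>
    have "e k = 0" if k: "k \<le> n - 1" for k
    proof -
      have kK: "k \<le> K" using k ds n by simp
      have "pair s (p k) = L (Q' * p k)"
        by (simp add: pair_def s)
      also have "\<dots> = c 0 * coeff (p k) n * \<Delta> n"
        unfolding Q'_def using k ds kK deg by (intro L_combination[OF c _ m]) auto
      also have "coeff (p k) n = 0"
        using k ds kK deg by (intro coeff_eq_0) auto
      finally have "pair s (p k) = 0" by simp
      moreover have "pair s (p k) = (\<Sum>l\<le>n - 1. e l * pair (p l) (p k))"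
        unfolding e by (rule pair_sum)
      moreover have "\<dots> = (\<Sum>l\<in>{k}. e l * pair (p l) (p k))"
        using k ds n kK by (intro sum.mono_neutral_right) (auto simp: ortho)
      ultimately show ?thesis using norm[OF kK] by simp
    qed
    then have "s = 0" unfolding e by simp
    then show False using \<open>s \<noteq> 0\<close> by simp
  qed
  then have Q'0: "Q' = 0" by (simp add: s)
  have "Max J \<in> J" and J_le: "j \<le> Max J" if "j \<in> J" for j
    using \<open>finite J\<close> \<open>J \<noteq> {}\<close> that by auto
  then have MJ: "Max J < ?m" "c (Max J) \<noteq> 0"
    using \<open>J \<noteq> {}\<close> by (auto simp: J_def)
  \<comment> \<open>Otherwise \<open>q (n + Max J)\<close> has the strictly largest degree among the
    nonzero terms, and its leading coefficient would survive in \<open>Q' = 0\<close>.\<close>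
  have "n + Max J < b"
  proof (rule ccontr)
    assume bn: "\<not> n + Max J < b"
    have z: "c j * coeff (q (n + j)) (n + Max J - b) = 0" if "j < ?m" "j \<noteq> Max J" for j
    proof (cases "c j = 0")
      case False
      then have "j \<in> J" using that by (simp add: J_def)
      then have "j < Max J" using J_le[of j] that(2) by (metis le_neq_implies_less)
      then show ?thesis
        using degree_q[of "n + j"] bn by (cases "n + j < b") (auto simp: q_low intro!: coeff_eq_0)
    qed simp
    have "0 = coeff Q' (n + Max J - b)" by (simp add: Q'0)
    also have "\<dots> = (\<Sum>j<?m. c j * coeff (q (n + j)) (n + Max J - b))"
      by (simp add: Q'_def coeff_sum)
    also have "\<dots> = (\<Sum>j\<in>{Max J}. c j * coeff (q (n + j)) (n + Max J - b))"
      using z MJ by (intro sum.mono_neutral_right) auto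
    also have "\<dots> = c (Max J) / fact (n + Max J - b)"
      using coeff_q[of "n + Max J"] bn by simp
    finally show False using MJ by simp
  qed
  have Min: "Min J \<in> J"
    using \<open>finite J\<close> \<open>J \<noteq> {}\<close> by (rule Min_in)
  then have mJ: "Min J < ?m" "c (Min J) \<noteq> 0"
    by (auto simp: J_def)
  have low: "n + Min J < b"
    using J_le[OF Min] \<open>n + Max J < b\<close> by linarith
  have c0: "c j = 0" if "j < Min J" for j
  proof (rule ccontr)
    assume "c j \<noteq> 0"
    then have "j \<in> J" using that mJ by (simp add: J_def)
    then show False using Min_le[OF \<open>finite J\<close>] that by (simp add: leD)
  qed
  have shift: "(\<Sum>j<?m. f j) = (\<Sum>j<?m - Min J. f (Min J + j))"
    if "\<And>j. j < Min J \<Longrightarrow> f j = 0" for f :: "nat \<Rightarrow> 'z :: comm_monoid_add"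
  proof -
    have "(\<Sum>j<?m. f j) = (\<Sum>j\<in>{Min J..<?m}. f j)"
      using that by (intro sum.mono_neutral_right) auto
    also have "\<dots> = (\<Sum>j<?m - Min J. f (Min J + j))"
      by (rule sum.reindex_bij_witness[of _ "\<lambda>j. Min J + j" "\<lambda>j. j - Min J"]) auto
    finally show ?thesis .
  qed
  \<comment> \<open>With its leading zeros cut off, the combination starts at n + Min J; the
    monomial of that degree isolates \<open>c (Min J)\<close>.\<close>
  have "L ((\<Sum>j<?m - Min J. smult (c (Min J + j)) (q (n + Min J + j))) * monom 1 (n + Min J))
      = c (Min J + 0) * coeff (monom 1 (n + Min J)) (n + Min J) * \<Delta> (n + Min J)"
  proof (rule L_combination)
    fix i assume "i < ?m"
    from c[OF this] show "(\<Sum>j<?m - Min J. c (Min J + j) * entry i (n + Min J + j)) = 0"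
      by (subst (asm) shift) (simp_all add: c0 add.assoc)
  qed (use mJ in \<open>auto simp: degree_monom_eq\<close>)
  moreover have "(\<Sum>j<?m - Min J. smult (c (Min J + j)) (q (n + Min J + j))) = Q'"
    unfolding Q'_def by (subst shift) (simp_all add: c0 add.assoc)
  ultimately show False
    using mJ \<Delta>_low[OF low] by (simp add: Q'0 L_0)
qed

end

section \<open>Assembly for the measure multiplied by the polynomial of U\<close>

lemma lambda_ab_inj_on:
  assumes "\<forall>u\<in>U. \<forall>v\<in>U. u + v \<noteq> - of_nat a - of_nat b - 1"
  shows "inj_on (lambda_ab a b) U"
proof (rule inj_onI)
  fix u v assume uv: "u \<in> U" "v \<in> U" and eq: "lambda_ab a b u = lambda_ab a b v"
  \<comment> \<open>The hypothesis on u + v says that the second factor never vanishes on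
    \<open>U\<close>.\<close>
  have "(u - v) * (u + v - (- of_nat a - of_nat b - 1)) = lambda_ab a b u - lambda_ab a b v"
    by (simp add: lambda_ab_def algebra_simps)
  then have "(u - v) * (u + v - (- of_nat a - of_nat b - 1)) = 0"
    using eq by simp
  moreover have "u + v - (- of_nat a - of_nat b - 1) \<noteq> 0"
    using assms uv by (metis eq_iff_diff_eq_0)
  ultimately show "u = v" by simp
qed

theorem theorem7p1:
  fixes a b N nS :: nat and M :: "nat \<Rightarrow> real" and U :: "complex set"
  assumes "1 \<le> b" and "b \<le> a" and "a \<le> N"
    and "\<forall>i<b. M i \<noteq> 0 \<and> M i \<noteq> 1"
    and "finite U"
    and "\<forall>u\<in>U. \<forall>v\<in>U. u + v \<noteq> - of_nat a - of_nat b - 1"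
    and "nS = card ((\<lambda>i::int. lambda_ab a b (of_int i)) ` {- int b..int N} - lambda_ab a b ` U)"
    and "nS > 0"
  shows "((\<exists>p. orthogonal_polys (nu_measure_U a b N M U) (nS - 1) p)
          \<longleftrightarrow> (\<forall>n\<le>nS. Psi a b N M U n \<noteq> 0)) \<and>
    ((\<forall>n\<le>nS. Psi a b N M U n \<noteq> 0) \<longrightarrow>
      (\<forall>n<nS. U_poly a b U * r_poly a b N M U n = r_det a b N M U n) \<and>
      orthogonal_polys (nu_measure_U a b N M U) (nS - 1) (r_poly a b N M U) \<and>
      (\<forall>n<nS. pairing (nu_measure_U a b N M U) (r_poly a b N M U n) (r_poly a b N M U n)
        = fact n * (pochhammer (- of_nat N - of_nat a - of_nat b) n)\<^sup>2
            * pochhammer (of_nat N + of_nat b + 1 - of_nat n) a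
          / ((-1) ^ (card U + b) * fact (n + card U)
              * (pochhammer (of_nat N + of_nat b + 1) a)\<^sup>2)
          * Psi a b N M U n * Psi a b N M U (n + 1)))"
proof -
  interpret dual_hahn_parameters a b N
    by unfold_locales (use assms in auto)
  \<comment> \<open>The list follows the order of \<open>U\<close>, not that of the images, as do
    the rows of \<open>Psi\<close>.\<close>
  define us where "us = map (lambda_ab a b) (complex_lex.sorted_list_of_set U)"
  define L where "L p = integral_dm (nu_measure a b N M) (poly p)" for p
  have inj: "inj_on (lambda_ab a b) U"
    using assms(6) by (rule lambda_ab_inj_on)
  have set_us: "set us = lambda_ab a b ` U" and length_us: "length us = card U"
    using assms(5) by (simp_all add: us_def)
  have us_nth: "us ! i = lambda_ab a b (complex_lex.sorted_list_of_set U ! i)" if "i < card U" for i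
    using that assms(5) by (simp add: us_def)
  have "\<forall>i. \<exists>c. i < b \<longrightarrow> (\<forall>k. T M i k = c * W_entry a b N M k (a + i) 0)"
    using W_entry_eq_T assms(4) by blast
  then obtain c where c: "\<And>i k. i < b \<Longrightarrow> T M i k = c i * W_entry a b N M k (a + i) 0"
    by metis
  \<comment> \<open>The factors \<open>c i\<close> go into the coefficients that depend on the test
    polynomial, so the rows are those of \<open>Psi\<close> itself and no determinant is
    rescaled.\<close>
  interpret D: determinantal_polynomials b q "\<lambda>i k. W_entry a b N M k (a + i) 0" L
    "\<lambda>i p. poly p (node i) * c i" Delta us
  proof
    show "L (p + r) = L p + L r" for p r
      by (simp add: L_def integral_nu_measure distrib_right sum.distrib)
    show "L (smult x p) = x * L p" for x p
      by (simp add: L_def integral_nu_measure sum_distrib_left mult.assoc)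
    show "k < b \<Longrightarrow> q k = 0" for k
      by (rule q_low)
    show "b \<le> k \<Longrightarrow> degree (q k) \<le> k - b" "b \<le> k \<Longrightarrow> coeff (q k) (k - b) = 1 / fact (k - b)" for k
      unfolding q_def using degree_dual_hahn_le[of "k - b"] coeff_dual_hahn[of "k - b"]
      by (simp_all add: of_nat_diff)
    show "L (q k * p) = (\<Sum>i<b. poly p (node i) * c i * W_entry a b N M k (a + i) 0) + coeff p k * Delta k"
      if "degree p \<le> k" for k p
      unfolding L_def integral_q_eq_defect defect_eq[OF that] by (simp add: c mult.assoc)
    show "distinct us"
      using inj assms(5) by (simp add: us_def distinct_map)
    show "k < b \<Longrightarrow> Delta k \<noteq> 0" for k
      by (rule Delta_nonzero) simp
  qed
  have R: "R_entry a b N n j = q (n + j)" for n j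
    by (simp add: R_entry_def q_def algebra_simps)
  have Psi: "Psi a b N M U n = D.psi n" for n
    unfolding Psi_def D.psi_def Let_def length_us
    by (intro arg_cong[of _ _ Determinant.det] eq_matI)
       (auto simp: D.entry_def R us_nth length_us W_entry_shift[of M n])
  have r_det: "r_det a b N M U n = D.Q n" for n
    unfolding r_det_def D.Q_def Let_def length_us
    by (intro arg_cong[of _ _ Determinant.det] eq_matI)
       (auto simp: D.entry_def R us_nth length_us W_entry_shift[of M n])
  have U_poly: "U_poly a b U = D.V"
    unfolding U_poly_def D.V_def set_us using inj by (simp add: prod.reindex)
  have r_poly: "r_poly a b N M U = D.r"
    by (rule ext) (simp add: r_poly_def D.r_def r_det U_poly)
  have pairing: "pairing (nu_measure_U a b N M U) p s = D.pair p s" for p s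
    unfolding nu_measure_U_def pairing_poly_times D.pair_def L_def U_poly ..
  \<comment> \<open>This keeps the degrees up to \<open>nS - 1\<close> within N + b, where
    \<open>Delta\<close> is nonzero.\<close>
  have "nS \<le> card ((\<lambda>i::int. lambda_ab a b (of_int i)) ` {- int b..int N})"
    unfolding assms(7) by (intro card_mono) auto
  also have "\<dots> \<le> card {- int b..int N}"
    by (rule card_image_le) simp
  finally have nS: "nS \<le> N + b + 1" by simp
  have norm: "pairing (nu_measure_U a b N M U) (D.r n) (D.r n)
        = fact n * (pochhammer (- of_nat N - of_nat a - of_nat b) n)\<^sup>2
            * pochhammer (of_nat N + of_nat b + 1 - of_nat n) a
          / ((-1) ^ (card U + b) * fact (n + card U)
              * (pochhammer (of_nat N + of_nat b + 1) a)\<^sup>2)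
          * Psi a b N M U n * Psi a b N M U (n + 1)" for n
  proof -
    have "(- 1 :: complex) ^ (b + card U) = 1 / (- 1) ^ (card U + b)"
      by (simp add: minus_one_power_iff)
    then show ?thesis
      unfolding pairing D.pair_r_self Psi length_us Delta_def by (simp add: mult_ac)
  qed
  have r_orthogonal: "orthogonal_polys (nu_measure_U a b N M U) (nS - 1) D.r"
    if "\<forall>n\<le>nS. Psi a b N M U n \<noteq> 0"
    unfolding orthogonal_polys_def pairing
  proof (intro conjI allI impI)
    fix n assume n: "n \<le> nS - 1"
    then have psi: "D.psi n \<noteq> 0" "D.psi (Suc n) \<noteq> 0"
      using that assms(8) by (auto simp: Psi)
    then show "degree (D.r n) = n" by (intro D.degree_r)
    have "Delta n \<noteq> 0" using n nS by (intro Delta_nonzero) linarith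
    then show "D.pair (D.r n) (D.r n) \<noteq> 0"
      using psi by (simp add: D.pair_r_self)
  qed (rule D.pair_r_r)
  have "Psi a b N M U n \<noteq> 0" if "orthogonal_polys (nu_measure_U a b N M U) (nS - 1) p" and "n \<le> nS" for p n
    unfolding Psi using that assms(8)
    by (intro D.psi_nonzero[of "nS - 1" p n]) (auto simp: orthogonal_polys_def pairing)
  then show ?thesis
    using r_orthogonal norm unfolding r_poly U_poly r_det D.V_times_r by blast
qed

end
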